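(* Let $\alpha>0$ be a constant independent of $n$, let $m=\alpha n$, and let $H$ be an $m\times n$ random matrix with i.i.d. standard normal entries. Let $$\xi_p=\max_{\mathbf{x}\in\{-\frac{1}{\sqrt n},\frac{1}{\sqrt n}\}^n}\|H\mathbf{x}\|_2 .$$ Let $\epsilon_1^{(m)},\epsilon_1^{(n)},\epsilon_5^{(g)}>0$ be arbitrarily small constants independent of $n$, and let $\xi_p^{(u)}$ be a scalar (depending on $n$) such that $$(1+\epsilon_1^{(m)})\sqrt{\alpha}+(1+\epsilon_1^{(n)})\sqrt{\tfrac{2}{\pi}}+\epsilon_5^{(g)}<\frac{\xi_p^{(u)}}{\sqrt n}.$$ Then $$\lim_{n\to\infty}P\big(\xi_p\le \xi_p^{(u)}\big)\ge 1,\qquad\text{equivalently}\qquad \lim_{n\to\infty}P\big(\xi_p^2\le (\xi_p^{(u)})^2\big)\ge 1,$$ and $$\frac{E\xi_p}{\sqrt n}\le \sqrt{\alpha}+\sqrt{\tfrac{2}{\pi}} .$$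
   Context: The limit $n\to\infty$ is taken along $n$ for which $m=\alpha n$ is a positive integer, with $\alpha$ and all the $\epsilon$'s fixed. A probability limit being $\ge 1$ means that it equals $1$. $\|\cdot\|_2$ is the Euclidean norm. *)

theory Defs
  imports "HOL-Probability.Probability"
begin

text \<open>
  Matrices whose dimensions vary with \<open>n\<close> are functions \<open>A i j\<close> of row \<open>i < m\<close> and column \<open>j < n\<close>;
  values outside this range are irrelevant.
\<close>

definition std_normal_matrix ::
    "'a measure \<Rightarrow> nat \<Rightarrow> nat \<Rightarrow> (nat \<Rightarrow> nat \<Rightarrow> 'a \<Rightarrow> real) \<Rightarrow> bool" where
  "std_normal_matrix M m n H \<longleftrightarrow>
     prob_space M \<and>
     prob_space.indep_vars M (\<lambda>_. borel) (\<lambda>(i, j). H i j) ({..<m} \<times> {..<n}) \<and>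
     (\<forall>i<m. \<forall>j<n. distributed M lborel (H i j) std_normal_density)"

definition scaled_cube :: "nat \<Rightarrow> (nat \<Rightarrow> real) set" where
  "scaled_cube n = ({..<n} \<rightarrow>\<^sub>E {- 1 / sqrt (real n), 1 / sqrt (real n)})"

definition mat_vec :: "nat \<Rightarrow> (nat \<Rightarrow> nat \<Rightarrow> real) \<Rightarrow> (nat \<Rightarrow> real) \<Rightarrow> nat \<Rightarrow> real" where
  "mat_vec n A x i = (\<Sum>j<n. A i j * x j)"

definition xi_p :: "nat \<Rightarrow> nat \<Rightarrow> (nat \<Rightarrow> nat \<Rightarrow> real) \<Rightarrow> real" where
  "xi_p m n A = Max ((\<lambda>x. L2_set (mat_vec n A x) {..<m}) ` scaled_cube n)"

definition admissible :: "real \<Rightarrow> nat set" where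
  "admissible \<alpha> = {n. \<exists>m::nat. 0 < m \<and> real m = \<alpha> * real n}"

text \<open>The floor is exact for \<open>n \<in> admissible \<alpha>\<close>, which is where it matters.\<close>

definition row_dim :: "real \<Rightarrow> nat \<Rightarrow> nat" where
  "row_dim \<alpha> n = nat \<lfloor>\<alpha> * real n\<rfloor>"

text \<open>
  The filter for \<open>n \<rightarrow> \<infinity>\<close> along admissible \<open>n\<close>. For \<open>\<alpha> > 0\<close> there are infinitely many of these if
  \<open>\<alpha>\<close> is rational; if \<open>\<alpha>\<close> is irrational there are none and the filter is trivial.
\<close>

definition at_top_admissible :: "real \<Rightarrow> nat filter" where
  "at_top_admissible \<alpha> = inf sequentially (principal (admissible \<alpha>))"

end

theory Submission
  imports Defs "HOL-Real_Asymp.Real_Asymp"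
begin

text \<open>
  Everything follows from one exponential moment bound. Write \<open>B = sqrt m + sqrt (2 n / \<pi>)\<close>, which is
  \<open>sqrt n * (sqrt \<alpha> + sqrt (2 / \<pi>))\<close> when \<open>m = \<alpha> n\<close>. For \<open>0 < l < sqrt m / 2\<close>,
  \<open>E (exp (l \<xi>)) \<le> exp (l B + l\<^sup>2)\<close> (lemma \<open>std_normal_matrix_mgf\<close>). Since \<open>1 + l \<xi> \<le> exp (l \<xi>)\<close>, dividing by
  \<open>l\<close> and letting \<open>l\<close> tend to \<open>0\<close> gives \<open>E \<xi> \<le> B\<close>. Markov's inequality with \<open>l\<close> a small multiple of
  \<open>sqrt n\<close> shows that \<open>\<xi>\<close> exceeds \<open>B + \<epsilon> sqrt n\<close> with exponentially small probability.

  The moment bound is Gordon's comparison. The norm \<open>\<parallel>H x\<parallel>\<close> is the supremum of \<open>\<langle>y, H x\<rangle>\<close> over unit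
  vectors \<open>y\<close>, so \<open>\<xi>\<close> is the supremum of a Gaussian process indexed by pairs \<open>(x, y)\<close> of unit vectors.
  With \<open>g\<close>, \<open>h\<close> and \<open>\<gamma>\<close> a further independent standard Gaussian vector in \<open>\<real>\<^sup>m\<close>, vector in \<open>\<real>\<^sup>n\<close> and scalar,
  the processes
  \<open>\<langle>y, H x\<rangle> + \<gamma>\<close> and \<open>\<langle>y, g\<rangle> + \<langle>x, h\<rangle>\<close> have the same variances, and the covariances of the first
  exceed those of the second by \<open>(1 - \<langle>x, x'\<rangle>) (1 - \<langle>y, y'\<rangle>) \<ge> 0\<close>. By Slepian's principle the more
  correlated process has the smaller maximum, here in the sense of exponential moments
  (\<open>gaussian_comparison_exp_Max\<close>). The maximum of the second process is at most
  \<open>\<parallel>g\<parallel> + (\<Sum>j. \<bar>h j\<bar>) / sqrt n\<close>, whose coordinates are independent, so its exponential moment factors into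
  one-dimensional integrals. Slepian's principle needs finitely many indices; a finite net of
  the sphere (\<open>sphere_net\<close>) replaces \<open>\<parallel>H x\<parallel>\<close> by at least \<open>(1 - \<epsilon>) \<parallel>H x\<parallel>\<close>, and \<open>\<epsilon>\<close> disappears because the
  bound is continuous in \<open>l\<close>.

  Slepian's principle itself is proved by rotating one process into the other and
  integrating by parts in each Gaussian coordinate (\<open>slepian_smooth\<close>).
\<close>

section \<open>The standard normal distribution on the line\<close>

abbreviation std_gauss :: "real measure" where
  "std_gauss \<equiv> density lborel (\<lambda>x. ennreal (std_normal_density x))"

lemma prob_space_std_gauss: "prob_space std_gauss"
  by (rule prob_space_normal_density) simp

lemma nn_integral_std_gauss:
  assumes [measurable]: "f \<in> borel_measurable borel"
  shows "(\<integral>\<^sup>+x. f x \<partial>std_gauss) = (\<integral>\<^sup>+x. ennreal (std_normal_density x) * f x \<partial>lborel)"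
  by (rule nn_integral_density) auto

lemma std_normal_density_shift:
  "std_normal_density x * exp (s * x) = exp (s\<^sup>2 / 2) * std_normal_density (x - s)"
  by (simp add: std_normal_density_def exp_add[symmetric] field_simps power2_eq_square)

lemma gauss_mgf:
  "(\<integral>\<^sup>+x. ennreal (exp (s * x)) \<partial>std_gauss) = ennreal (exp (s\<^sup>2 / 2))"
proof -
  have "(\<integral>\<^sup>+x. ennreal (exp (s * x)) \<partial>std_gauss) =
      (\<integral>\<^sup>+x. ennreal (exp (s\<^sup>2 / 2)) * ennreal (std_normal_density (- s + 1 * x)) \<partial>lborel)"
    by (subst nn_integral_std_gauss)
      (auto intro!: nn_integral_cong simp: ennreal_mult[symmetric] std_normal_density_shift)
  also have "\<dots> = ennreal (exp (s\<^sup>2 / 2)) * (\<integral>\<^sup>+x. ennreal (std_normal_density (- s + 1 * x)) \<partial>lborel)"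
    by (rule nn_integral_cmult) auto
  also have "(\<integral>\<^sup>+x. ennreal (std_normal_density (- s + 1 * x)) \<partial>lborel) =
      (\<integral>\<^sup>+x. ennreal (std_normal_density x) \<partial>lborel)"
    using nn_integral_real_affine[of "\<lambda>x. ennreal (std_normal_density x)" 1 "- s"] by simp
  also have "\<dots> = 1"
    using prob_space.emeasure_space_1[OF prob_space_std_gauss] by (simp add: emeasure_density)
  finally show ?thesis by simp
qed

lemma nn_integral_gauss_half: "(\<integral>\<^sup>+x. ennreal (std_normal_density x) * indicator {0..} x \<partial>lborel) = ennreal (1/2)"
proof -
  have neg: "(\<integral>\<^sup>+x. ennreal (std_normal_density x) * indicator {..0} x \<partial>lborel) =
      (\<integral>\<^sup>+x. ennreal (std_normal_density x) * indicator {0..} x \<partial>lborel)" (is "?N = ?P")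
    using nn_integral_real_affine[of "\<lambda>x. ennreal (std_normal_density x) * indicator {..0} x" "-1" 0]
    by (simp add: std_normal_density_def indicator_def)
  have "1 = (\<integral>\<^sup>+x. ennreal (std_normal_density x) \<partial>lborel)"
    using prob_space.emeasure_space_1[OF prob_space_std_gauss] by (simp add: emeasure_density)
  also have "\<dots> = (\<integral>\<^sup>+x. (ennreal (std_normal_density x) * indicator {..0} x +
      ennreal (std_normal_density x) * indicator {0..} x) \<partial>lborel)"
    using AE_lborel_singleton[of "0::real"]
    by (intro nn_integral_cong_AE) (auto simp: indicator_def elim!: eventually_mono)
  also have "\<dots> = ?N + ?P"
    by (rule nn_integral_add) auto
  finally have *: "?P + ?P = 1" by (simp add: neg)
  then obtain r where r: "?P = ennreal r" "0 \<le> r" by (cases ?P) auto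
  with * have "ennreal (r + r) = ennreal 1" by (simp add: ennreal_plus[symmetric] del: ennreal_plus)
  then have "r = 1/2" using r(2) by (subst (asm) ennreal_inj) auto
  with r show ?thesis by simp
qed

text \<open>
  The left-hand side is \<open>2 exp (s\<^sup>2 / 2) \<Phi>(s)\<close> by completing the square, and
  \<open>\<Phi>(s) \<le> 1/2 + s / sqrt (2 \<pi>)\<close> because the density is largest at \<open>0\<close>. The coefficient \<open>sqrt (2 / \<pi>)\<close> of
  \<open>s\<close> is the mean of \<open>\<bar>x\<bar>\<close>; it has to be exact, since it becomes the constant of the expectation bound.
\<close>

lemma gauss_mgf_abs_le:
  assumes "0 \<le> s"
  shows "(\<integral>\<^sup>+x. ennreal (exp (s * \<bar>x\<bar>)) \<partial>std_gauss) \<le> ennreal (exp (s * sqrt (2 / pi) + s\<^sup>2 / 2))"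
proof -
  let ?\<phi> = std_normal_density
  have "(\<integral>\<^sup>+x. ennreal (exp (s * \<bar>x\<bar>)) \<partial>std_gauss) =
      (\<integral>\<^sup>+x. ennreal (?\<phi> x * exp (s * \<bar>x\<bar>)) \<partial>lborel)"
    by (subst nn_integral_std_gauss) (auto intro!: nn_integral_cong simp: ennreal_mult[symmetric])
  also have "\<dots> = (\<integral>\<^sup>+x. (ennreal (?\<phi> x * exp (s * \<bar>x\<bar>)) * indicator {..0} x +
      ennreal (?\<phi> x * exp (s * \<bar>x\<bar>)) * indicator {0..} x) \<partial>lborel)"
    using AE_lborel_singleton[of "0::real"]
    by (intro nn_integral_cong_AE) (auto simp: indicator_def elim!: eventually_mono)
  also have "\<dots> = (\<integral>\<^sup>+x. ennreal (?\<phi> x * exp (s * \<bar>x\<bar>)) * indicator {..0} x \<partial>lborel) +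
      (\<integral>\<^sup>+x. ennreal (?\<phi> x * exp (s * \<bar>x\<bar>)) * indicator {0..} x \<partial>lborel)" (is "_ = ?N + ?P")
    by (rule nn_integral_add) auto
  also have "?N = ?P"
    using nn_integral_real_affine[of "\<lambda>x. ennreal (?\<phi> x * exp (s * \<bar>x\<bar>)) * indicator {..0} x" "-1" 0]
    by (simp add: std_normal_density_def indicator_def)
  also have "?P = (\<integral>\<^sup>+x. ennreal (exp (s\<^sup>2 / 2)) * (ennreal (?\<phi> (- s + 1 * x)) * indicator {-s..} (- s + 1 * x)) \<partial>lborel)"
    by (auto intro!: nn_integral_cong simp: ennreal_mult[symmetric] std_normal_density_shift indicator_def)
  also have "\<dots> = ennreal (exp (s\<^sup>2 / 2)) * (\<integral>\<^sup>+x. ennreal (?\<phi> (- s + 1 * x)) * indicator {-s..} (- s + 1 * x) \<partial>lborel)"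
    by (rule nn_integral_cmult) auto
  also have "(\<integral>\<^sup>+x. ennreal (?\<phi> (- s + 1 * x)) * indicator {-s..} (- s + 1 * x) \<partial>lborel) =
      (\<integral>\<^sup>+x. ennreal (?\<phi> x) * indicator {-s..} x \<partial>lborel)"
    using nn_integral_real_affine[of "\<lambda>x. ennreal (?\<phi> x) * indicator {-s..} x" 1 "- s"] by simp
  finally have split: "(\<integral>\<^sup>+x. ennreal (exp (s * \<bar>x\<bar>)) \<partial>std_gauss) =
      ennreal (exp (s\<^sup>2 / 2)) * (\<integral>\<^sup>+x. ennreal (?\<phi> x) * indicator {-s..} x \<partial>lborel) +
      ennreal (exp (s\<^sup>2 / 2)) * (\<integral>\<^sup>+x. ennreal (?\<phi> x) * indicator {-s..} x \<partial>lborel)" (is "_ = _ * ?J + _")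
    .
  have "?J \<le> (\<integral>\<^sup>+x. (ennreal (?\<phi> x) * indicator {0..} x + ennreal (1 / sqrt (2 * pi)) * indicator {-s..0} x) \<partial>lborel)"
    using assms by (intro nn_integral_mono)
      (auto simp: indicator_def std_normal_density_def intro!: ennreal_leI divide_right_mono)
  also have "\<dots> = ennreal (1/2) + ennreal (1 / sqrt (2 * pi)) * emeasure lborel {-s..0}"
    by (subst nn_integral_add) (auto simp: nn_integral_gauss_half nn_integral_cmult_indicator)
  also have "\<dots> = ennreal (1/2 + s / sqrt (2 * pi))"
  proof -
    have "ennreal (1 / sqrt (2 * pi)) * emeasure lborel {-s..0} = ennreal (s / sqrt (2 * pi))"
      using assms by (simp add: ennreal_mult[symmetric])
    then show ?thesis using assms by (subst ennreal_plus) auto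
  qed
  finally have J: "?J \<le> ennreal (1/2 + s / sqrt (2 * pi))" .
  have "(\<integral>\<^sup>+x. ennreal (exp (s * \<bar>x\<bar>)) \<partial>std_gauss) \<le>
      ennreal (exp (s\<^sup>2 / 2)) * ennreal (1/2 + s / sqrt (2 * pi)) + ennreal (exp (s\<^sup>2 / 2)) * ennreal (1/2 + s / sqrt (2 * pi))"
    unfolding split by (intro add_mono mult_left_mono J) auto
  also have "\<dots> = ennreal (exp (s\<^sup>2 / 2) * (1 + s * (2 / sqrt (2 * pi))))"
    using assms by (auto simp: ennreal_mult[symmetric] ennreal_plus[symmetric] algebra_simps simp del: ennreal_plus)
  also have "2 / sqrt (2 * pi) = sqrt (2 / pi)"
    by (simp add: real_sqrt_divide real_sqrt_mult field_simps)
  also have "exp (s\<^sup>2 / 2) * (1 + s * sqrt (2 / pi)) \<le> exp (s\<^sup>2 / 2) * exp (s * sqrt (2 / pi))"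
    by (intro mult_left_mono exp_ge_add_one_self) auto
  finally show ?thesis by (simp add: exp_add[symmetric] add.commute ennreal_leI)
qed

text \<open>
  The integrand against the density is a multiple of a normal density of variance \<open>1 / (1 - 2 a)\<close>, so
  the integral equals \<open>(1 - 2 a) powr (- 1/2)\<close>. The range of \<open>a\<close> keeps \<open>2 a\<close> in the interval where the
  logarithm has its elementary quadratic lower bound.
\<close>

lemma gauss_mgf_square_le:
  assumes "0 \<le> a" "a \<le> 1/4"
  shows "(\<integral>\<^sup>+x. ennreal (exp (a * x\<^sup>2)) \<partial>std_gauss) \<le> ennreal (exp (a + 4 * a\<^sup>2))"
proof -
  define \<sigma> where "\<sigma> = 1 / sqrt (1 - 2 * a)"
  have \<sigma>: "\<sigma> > 0" "\<sigma>\<^sup>2 = 1 / (1 - 2 * a)" using assms by (auto simp: \<sigma>_def power_divide)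
  have dens: "std_normal_density x * exp (a * x\<^sup>2) = \<sigma> * normal_density 0 \<sigma> x" for x
  proof -
    have "sqrt (2 * pi * \<sigma>\<^sup>2) = sqrt (2 * pi) * \<sigma>" using \<sigma>(1) by (simp add: real_sqrt_mult)
    moreover have "- x\<^sup>2 / 2 + a * x\<^sup>2 = - x\<^sup>2 / (2 * \<sigma>\<^sup>2)" using assms by (simp add: \<sigma>(2) field_simps)
    ultimately show ?thesis using \<sigma>(1)
      by (simp add: normal_density_def exp_add[symmetric])
  qed
  have "(\<integral>\<^sup>+x. ennreal (exp (a * x\<^sup>2)) \<partial>std_gauss) =
      (\<integral>\<^sup>+x. ennreal \<sigma> * ennreal (normal_density 0 \<sigma> x) \<partial>lborel)"
    using \<sigma> by (subst nn_integral_std_gauss) (auto intro!: nn_integral_cong simp: ennreal_mult[symmetric] dens)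
  also have "\<dots> = ennreal \<sigma> * (\<integral>\<^sup>+x. ennreal (normal_density 0 \<sigma> x) \<partial>lborel)"
    by (rule nn_integral_cmult) auto
  also have "(\<integral>\<^sup>+x. ennreal (normal_density 0 \<sigma> x) \<partial>lborel) = 1"
    using prob_space.emeasure_space_1[OF prob_space_normal_density[OF \<sigma>(1), of 0]] by (simp add: emeasure_density)
  also have "\<sigma> = exp (- ln (1 - 2 * a) / 2)"
  proof -
    have "sqrt (1 - 2 * a) = exp (ln (1 - 2 * a) / 2)"
      using assms by (simp add: ln_sqrt[symmetric])
    then show ?thesis unfolding \<sigma>_def minus_divide_left[symmetric] exp_minus by (simp only: inverse_eq_divide)
  qed
  also have "\<dots> \<le> exp (a + 4 * a\<^sup>2)"
    using ln_one_minus_pos_lower_bound[of "2 * a"] assms by (simp add: power2_eq_square)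
  finally show ?thesis by (simp add: ennreal_leI)
qed

lemma integrable_std_gauss_iff:
  fixes f :: "real \<Rightarrow> real"
  assumes [measurable]: "f \<in> borel_measurable borel"
  shows "integrable std_gauss f \<longleftrightarrow> integrable lborel (\<lambda>x. std_normal_density x * f x)"
  by (subst integrable_density) auto

lemma integral_std_gauss:
  fixes f :: "real \<Rightarrow> real"
  assumes [measurable]: "f \<in> borel_measurable borel"
  shows "(\<integral>x. f x \<partial>std_gauss) = (\<integral>x. std_normal_density x * f x \<partial>lborel)"
  by (subst integral_density) auto

lemma gauss_integrable_ident: "integrable std_gauss (\<lambda>x::real. x)"
  using integrable_std_normal_moment[of 1] by (simp add: integrable_std_gauss_iff)

text \<open>
  The standard normal density \<open>\<phi>\<close> satisfies \<open>\<phi>' x = - x * \<phi> x\<close>, hence \<open>f' x * \<phi> x - x * f x * \<phi> x\<close> is the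
  derivative of \<open>f x * \<phi> x\<close>, which vanishes at both ends.
\<close>

lemma gauss_integration_by_parts:
  fixes f :: "real \<Rightarrow> real"
  assumes f: "\<And>x. (f has_real_derivative f' x) (at x)" and f': "continuous_on UNIV f'"
    and bounds: "\<And>x. \<bar>f x\<bar> \<le> B" "\<And>x. \<bar>f' x\<bar> \<le> B"
  shows "(\<integral>x. x * f x \<partial>std_gauss) = (\<integral>x. f' x \<partial>std_gauss)"
proof -
  let ?\<phi> = std_normal_density
  have contf: "continuous_on UNIV f" using f by (meson DERIV_continuous_on has_field_derivative_at_within)
  have [measurable]: "f \<in> borel_measurable borel" "f' \<in> borel_measurable borel"
    using contf f' by (auto intro: borel_measurable_continuous_onI)
  have int1: "integrable std_gauss (\<lambda>x. x * f x)"
    using gauss_integrable_ident[THEN integrable_mult_right, of B]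
    by (rule Bochner_Integration.integrable_bound)
      (use bounds(1) in \<open>auto simp: abs_mult intro!: AE_I2 mult_mono order_trans[OF bounds(1)] simp: mult.commute[of B]\<close>)
  have int2: "integrable std_gauss f'"
    using bounds(2) by (intro finite_measure.integrable_const_bound[where B = B])
      (auto intro: prob_space.axioms(1)[OF prob_space_std_gauss])
  have d\<phi>: "(?\<phi> has_real_derivative - x * ?\<phi> x) (at x)" for x
  proof -
    have "((\<lambda>x. c * exp (- x\<^sup>2 / 2)) has_real_derivative - x * (c * exp (- x\<^sup>2 / 2))) (at x)" for c :: real
      by (rule derivative_eq_intros refl | simp)+
    then show ?thesis unfolding std_normal_density_def .
  qed
  have i1: "integrable lborel (\<lambda>x. ?\<phi> x * (x * f x))" and i2: "integrable lborel (\<lambda>x. ?\<phi> x * f' x)"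
    using int1 int2 by (auto simp: integrable_std_gauss_iff)
  have ein: "einterval (-\<infinity>) \<infinity> = UNIV" by (auto simp: einterval_def)
  have lim\<phi>: "(?\<phi> \<longlongrightarrow> 0) at_top" "(?\<phi> \<longlongrightarrow> 0) at_bot"
    unfolding std_normal_density_def by real_asymp+
  have lim: "((\<lambda>x. f x * ?\<phi> x) \<longlongrightarrow> 0) F" if "(?\<phi> \<longlongrightarrow> 0) F" for F
  proof (rule Lim_null_comparison)
    show "\<forall>\<^sub>F x in F. norm (f x * ?\<phi> x) \<le> B * ?\<phi> x"
      by (auto simp: abs_mult intro!: always_eventually mult_right_mono bounds(1))
    show "((\<lambda>x. B * ?\<phi> x) \<longlongrightarrow> 0) F" using tendsto_mult_left[OF that, of B] by simp
  qed
  have "(LBINT x=-\<infinity>..\<infinity>. ?\<phi> x * f' x - ?\<phi> x * (x * f x)) = 0 - 0"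
  proof (rule interval_integral_FTC_integrable[where F = "\<lambda>x. f x * ?\<phi> x"])
    show "((\<lambda>x. f x * ?\<phi> x) has_vector_derivative ?\<phi> x * f' x - ?\<phi> x * (x * f x)) (at x)" for x
      using DERIV_mult[OF f d\<phi>, of x] by (simp add: has_real_derivative_iff_has_vector_derivative algebra_simps)
    show "isCont (\<lambda>x. ?\<phi> x * f' x - ?\<phi> x * (x * f x)) x" for x
      using f' contf by (auto simp: continuous_on_eq_continuous_at normal_density_def intro!: continuous_intros)
    show "set_integrable lborel (einterval (-\<infinity>) \<infinity>) (\<lambda>x. ?\<phi> x * f' x - ?\<phi> x * (x * f x))"
      using i1 i2 by (simp add: ein set_integrable_def)
    show "(((\<lambda>x. f x * ?\<phi> x) \<circ> real_of_ereal) \<longlongrightarrow> 0) (at_right (- \<infinity>))"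
      using lim[OF lim\<phi>(2)] by (simp add: ereal_tendsto_simps)
    show "(((\<lambda>x. f x * ?\<phi> x) \<circ> real_of_ereal) \<longlongrightarrow> 0) (at_left \<infinity>)"
      using lim[OF lim\<phi>(1)] by (simp add: ereal_tendsto_simps)
  qed simp
  then have "(\<integral>x. ?\<phi> x * f' x - ?\<phi> x * (x * f x) \<partial>lborel) = 0"
    by (simp add: interval_lebesgue_integral_def ein set_lebesgue_integral_def)
  then have "(\<integral>x. ?\<phi> x * f' x \<partial>lborel) = (\<integral>x. ?\<phi> x * (x * f x) \<partial>lborel)"
    by (subst (asm) Bochner_Integration.integral_diff[OF i2 i1]) simp
  moreover have "(\<integral>x. x * f x \<partial>std_gauss) = (\<integral>x. ?\<phi> x * (x * f x) \<partial>lborel)"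
    "(\<integral>x. f' x \<partial>std_gauss) = (\<integral>x. ?\<phi> x * f' x \<partial>lborel)"
    by (rule integral_std_gauss; measurable)+
  ultimately show ?thesis by simp
qed

section \<open>Slepian's comparison inequality\<close>

abbreviation gauss :: "'k set \<Rightarrow> ('k \<Rightarrow> real) measure" where
  "gauss K \<equiv> Pi\<^sub>M K (\<lambda>_. std_gauss)"

lemma product_prob_space_std_gauss: "product_prob_space (\<lambda>_. std_gauss)"
  by (intro product_prob_spaceI prob_space_std_gauss)

lemma prob_space_gauss: "prob_space (gauss K)"
  by (intro prob_space_PiM prob_space_std_gauss)

lemma gauss_integrable_component:
  assumes "finite K" "k \<in> K"
  shows "integrable (gauss K) (\<lambda>\<omega>. \<omega> k)"
proof -
  interpret product_prob_space "\<lambda>_. std_gauss" K by (rule product_prob_space_std_gauss)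
  interpret N: prob_space std_gauss by (rule prob_space_std_gauss)
  have "integrable (gauss K) (\<lambda>\<omega>. \<Prod>j\<in>K. (if j = k then \<omega> j else 1))"
    by (rule product_integrable_prod[OF assms(1), where f = "\<lambda>j x. if j = k then x else 1"])
      (rename_tac j, case_tac "j = k", auto simp: gauss_integrable_ident)
  then show ?thesis using assms by (simp add: prod.delta)
qed

lemma gauss_integrable_component_mult:
  fixes G :: "('k \<Rightarrow> real) \<Rightarrow> real"
  assumes K: "finite K" "k \<in> K" and [measurable]: "G \<in> borel_measurable (gauss K)"
    and B: "\<And>\<omega>. \<bar>G \<omega>\<bar> \<le> B"
  shows "integrable (gauss K) (\<lambda>\<omega>. \<omega> k * G \<omega>)"
proof (rule Bochner_Integration.integrable_bound)
  show "integrable (gauss K) (\<lambda>\<omega>. B * \<omega> k)"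
    using gauss_integrable_component[OF K] by (rule integrable_mult_right)
  show "(\<lambda>\<omega>. \<omega> k * G \<omega>) \<in> borel_measurable (gauss K)"
    using K by measurable
  have "0 \<le> B" using B[of undefined] by linarith
  then show "AE \<omega> in gauss K. norm (\<omega> k * G \<omega>) \<le> norm (B * \<omega> k)"
    using B by (intro AE_I2) (simp add: abs_mult mult.commute[of "\<bar>_ k\<bar>"] mult_right_mono)
qed

text \<open>
  Fubini's theorem isolates the coordinate \<open>k\<close>, and the one-dimensional formula applies to it.
\<close>

lemma gauss_coordinate_by_parts:
  fixes G G' :: "('k \<Rightarrow> real) \<Rightarrow> real"
  assumes K: "finite K" "k \<in> K" and [measurable]: "G \<in> borel_measurable (gauss K)" "G' \<in> borel_measurable (gauss K)"
    and B: "\<And>\<omega>. \<bar>G \<omega>\<bar> \<le> B" "\<And>\<omega>. \<bar>G' \<omega>\<bar> \<le> B"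
    and d: "\<And>\<omega> t. ((\<lambda>t. G ((\<omega>)(k := t))) has_real_derivative G' ((\<omega>)(k := t))) (at t)"
    and c: "\<And>\<omega>. continuous_on UNIV (\<lambda>t. G' ((\<omega>)(k := t)))"
  shows "(\<integral>\<omega>. \<omega> k * G \<omega> \<partial>gauss K) = (\<integral>\<omega>. G' \<omega> \<partial>gauss K)"
proof -
  interpret product_prob_space "\<lambda>_. std_gauss" K by (rule product_prob_space_std_gauss)
  interpret P: prob_space "gauss K" by (rule prob_space_gauss)
  have ins: "insert k (K - {k}) = K" using K by auto
  have fin: "finite (K - {k})" "k \<notin> K - {k}" using K by auto
  have int: "integrable (gauss K) G'"
    using B(2) by (intro P.integrable_const_bound[where B = B]) auto
  have "(\<integral>\<omega>. \<omega> k * G \<omega> \<partial>gauss K) =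
      (\<integral>\<omega>. (\<integral>t. t * G ((\<omega>)(k := t)) \<partial>std_gauss) \<partial>gauss (K - {k}))"
    using product_integral_insert[OF fin, unfolded ins, OF gauss_integrable_component_mult[OF K assms(3) B(1)]]
    by simp
  also have "\<dots> = (\<integral>\<omega>. (\<integral>t. G' ((\<omega>)(k := t)) \<partial>std_gauss) \<partial>gauss (K - {k}))"
    by (intro Bochner_Integration.integral_cong refl gauss_integration_by_parts[where B = B] d c B)
  also have "\<dots> = (\<integral>\<omega>. G' \<omega> \<partial>gauss K)"
    using product_integral_insert[OF fin, unfolded ins, OF int] by simp
  finally show ?thesis .
qed

lemma abs_prod_le_1:
  fixes f :: "'a \<Rightarrow> real"
  assumes "\<And>i. 0 \<le> f i" "\<And>i. f i \<le> 1"
  shows "\<bar>prod f A\<bar> \<le> 1"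
  using assms by (simp add: abs_prod prod_le_1)

text \<open>
  Slepian's inequality for a smooth decreasing cutoff \<open>\<psi>\<close>. The orthogonality assumption makes the
  Gaussian vectors \<open>(\<Sum>k. a i k * \<omega> k)\<^sub>i\<close> and \<open>(\<Sum>k. b i k * \<omega> k)\<^sub>i\<close> independent, so the rotated coefficients
  \<open>c \<theta> = cos \<theta> * b + sin \<theta> * a\<close> interpolate between them as \<open>\<theta>\<close> runs from \<open>0\<close> to \<open>\<pi>/2\<close>. Integration by parts
  turns the \<open>\<theta>\<close>-derivative of the expectation of \<open>F = (\<Prod>i. \<psi> (Z i))\<close> into \<open>sin \<theta> * cos \<theta>\<close> times the sum,
  over \<open>i\<close> and \<open>j\<close>, of the difference of covariances times the mean of the second partial derivative of
  \<open>F\<close> in the coordinates \<open>i\<close> and \<open>j\<close>. The diagonal terms, whose sign is not controlled, vanish because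
  the variances agree; for \<open>i \<noteq> j\<close> the partial derivative contains \<open>\<psi>' (Z i) * \<psi>' (Z j) \<ge> 0\<close>.
\<close>

theorem slepian_smooth:
  fixes a b :: "'i \<Rightarrow> 'k \<Rightarrow> real" and \<psi> \<psi>' \<psi>'' :: "real \<Rightarrow> real"
  assumes fin: "finite I" "finite K"
    and d\<psi>: "\<And>z. (\<psi> has_real_derivative \<psi>' z) (at z)"
    and d\<psi>': "\<And>z. (\<psi>' has_real_derivative \<psi>'' z) (at z)" and c\<psi>'': "continuous_on UNIV \<psi>''"
    and \<psi>: "\<And>z. 0 \<le> \<psi> z" "\<And>z. \<psi> z \<le> 1" and mono: "\<And>z. \<psi>' z \<le> 0"
    and bd: "\<And>z. \<bar>\<psi>' z\<bar> \<le> B" "\<And>z. \<bar>\<psi>'' z\<bar> \<le> B"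
    and orth: "\<And>i j. i \<in> I \<Longrightarrow> j \<in> I \<Longrightarrow> (\<Sum>k\<in>K. a i k * b j k) = 0"
    and var: "\<And>i. i \<in> I \<Longrightarrow> (\<Sum>k\<in>K. a i k * a i k) = (\<Sum>k\<in>K. b i k * b i k)"
    and cov: "\<And>i j. i \<in> I \<Longrightarrow> j \<in> I \<Longrightarrow> (\<Sum>k\<in>K. b i k * b j k) \<le> (\<Sum>k\<in>K. a i k * a j k)"
  shows "(\<integral>\<omega>. (\<Prod>i\<in>I. \<psi> (\<Sum>k\<in>K. b i k * \<omega> k)) \<partial>gauss K) \<le> (\<integral>\<omega>. (\<Prod>i\<in>I. \<psi> (\<Sum>k\<in>K. a i k * \<omega> k)) \<partial>gauss K)"
proof -
  interpret P: prob_space "gauss K" by (rule prob_space_gauss)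
  have B0: "0 \<le> B" using bd(1)[of 0] by linarith
  define c where "c \<theta> i k = cos \<theta> * b i k + sin \<theta> * a i k" for \<theta> :: real and i k
  define d where "d \<theta> i k = cos \<theta> * a i k - sin \<theta> * b i k" for \<theta> :: real and i k
  define Z where "Z \<theta> i \<omega> = (\<Sum>k\<in>K. c \<theta> i k * \<omega> k)" for \<theta> i and \<omega> :: "'k \<Rightarrow> real"
  define G where "G \<theta> i \<omega> = \<psi>' (Z \<theta> i \<omega>) * (\<Prod>j\<in>I - {i}. \<psi> (Z \<theta> j \<omega>))" for \<theta> i \<omega>
  \<comment> \<open>\<open>G\<close> is the partial derivative of \<open>F\<close> in \<open>Z i\<close>, and \<open>G'\<close> is its derivative in the coordinate \<open>\<omega> k\<close>.\<close>
  define G' where "G' \<theta> i k \<omega> = c \<theta> i k * (\<psi>'' (Z \<theta> i \<omega>) * (\<Prod>j\<in>I - {i}. \<psi> (Z \<theta> j \<omega>))) +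
      (\<Sum>j\<in>I - {i}. c \<theta> j k * (\<psi>' (Z \<theta> i \<omega>) * \<psi>' (Z \<theta> j \<omega>) * (\<Prod>l\<in>I - {i} - {j}. \<psi> (Z \<theta> l \<omega>))))" for \<theta> i k \<omega>
  define D where "D \<theta> \<omega> = (\<Sum>i\<in>I. \<Sum>k\<in>K. d \<theta> i k * (\<omega> k * G \<theta> i \<omega>))" for \<theta> \<omega>
  define F where "F \<theta> \<omega> = (\<Prod>i\<in>I. \<psi> (Z \<theta> i \<omega>))" for \<theta> \<omega>
  have c\<psi>: "continuous_on UNIV \<psi>" "continuous_on UNIV \<psi>'"
    using d\<psi> d\<psi>' by (meson DERIV_continuous_on has_field_derivative_at_within)+
  have [measurable]: "\<psi> \<in> borel_measurable borel" "\<psi>' \<in> borel_measurable borel" "\<psi>'' \<in> borel_measurable borel"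
    using c\<psi> c\<psi>'' by (auto intro: borel_measurable_continuous_onI)
  have [measurable]: "Z \<theta> i \<in> borel_measurable (gauss K)" for \<theta> i
    unfolding Z_def by measurable
  have [measurable]: "G \<theta> i \<in> borel_measurable (gauss K)" "G' \<theta> i k \<in> borel_measurable (gauss K)" for \<theta> i k
    unfolding G_def G'_def by measurable
  have P1: "\<bar>\<Prod>j\<in>J. \<psi> (Z \<theta> j \<omega>)\<bar> \<le> 1" for J \<theta> \<omega>
    using \<psi> by (rule abs_prod_le_1)
  have P0: "0 \<le> (\<Prod>j\<in>J. \<psi> (Z \<theta> j \<omega>))" for J \<theta> \<omega>
    using \<psi> by (simp add: prod_nonneg)
  have G_le: "\<bar>G \<theta> i \<omega>\<bar> \<le> B" for \<theta> i \<omega>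
    using mult_mono[OF bd(1) P1] B0 by (simp add: G_def abs_mult)
  have prod_le: "\<bar>x * y\<bar> \<le> B" if "\<bar>x\<bar> \<le> B" "\<bar>y\<bar> \<le> 1" for x y :: real
    using mult_mono[OF that] B0 by (simp add: abs_mult)
  have G'_le: "\<bar>G' \<theta> i k \<omega>\<bar> \<le> \<bar>c \<theta> i k\<bar> * B + (\<Sum>j\<in>I - {i}. \<bar>c \<theta> j k\<bar> * (B * B))" (is "_ \<le> ?C") for \<theta> i k \<omega>
  proof -
    have t1: "\<bar>c \<theta> i k * (\<psi>'' (Z \<theta> i \<omega>) * (\<Prod>j\<in>I - {i}. \<psi> (Z \<theta> j \<omega>)))\<bar> \<le> \<bar>c \<theta> i k\<bar> * B"
      unfolding abs_mult[of "c \<theta> i k"] by (intro mult_left_mono prod_le bd P1) auto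
    have t3: "\<bar>\<psi>' x * \<psi>' y * (\<Prod>l\<in>I - {i} - {j}. \<psi> (Z \<theta> l \<omega>))\<bar> \<le> B * B * 1" for x y j
      unfolding abs_mult by (intro mult_mono bd P1) (use B0 in auto)
    have t2: "\<bar>\<Sum>j\<in>I - {i}. c \<theta> j k * (\<psi>' (Z \<theta> i \<omega>) * \<psi>' (Z \<theta> j \<omega>) * (\<Prod>l\<in>I - {i} - {j}. \<psi> (Z \<theta> l \<omega>)))\<bar>
        \<le> (\<Sum>j\<in>I - {i}. \<bar>c \<theta> j k\<bar> * (B * B))"
    proof (rule order_trans[OF sum_abs sum_mono])
      fix j show "\<bar>c \<theta> j k * (\<psi>' (Z \<theta> i \<omega>) * \<psi>' (Z \<theta> j \<omega>) * (\<Prod>l\<in>I - {i} - {j}. \<psi> (Z \<theta> l \<omega>)))\<bar> \<le> \<bar>c \<theta> j k\<bar> * (B * B)"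
        unfolding abs_mult[of "c \<theta> j k"] using t3 by (intro mult_left_mono) auto
    qed
    show ?thesis unfolding G'_def using t1 t2 by linarith
  qed
  have Z_upd: "Z \<theta> i ((\<omega>)(k := t)) = Z \<theta> i \<omega> + c \<theta> i k * (t - \<omega> k)" if "k \<in> K" for \<theta> i \<omega> k t
  proof -
    have "Z \<theta> i ((\<omega>)(k := t)) - Z \<theta> i \<omega> = (\<Sum>k'\<in>K. if k' = k then c \<theta> i k * (t - \<omega> k) else 0)"
      unfolding Z_def sum_subtractf[symmetric] by (intro sum.cong) (auto simp: algebra_simps)
    then show ?thesis using that fin by simp
  qed
  have dZ: "((\<lambda>t. Z \<theta> i ((\<omega>)(k := t))) has_real_derivative c \<theta> i k) (at t)" if "k \<in> K" for \<theta> i \<omega> k t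
    unfolding Z_upd[OF that] by (auto intro!: derivative_eq_intros)
  have cZ: "continuous_on UNIV (\<lambda>t. Z \<theta> i ((\<omega>)(k := t)))" if "k \<in> K" for \<theta> i \<omega> k
    unfolding Z_upd[OF that] by (intro continuous_intros)
  have dG: "((\<lambda>t. G \<theta> i ((\<omega>)(k := t))) has_real_derivative G' \<theta> i k ((\<omega>)(k := t))) (at t)" if "k \<in> K" for \<theta> i \<omega> k t
  proof -
    have d1: "((\<lambda>t. \<psi>' (Z \<theta> i ((\<omega>)(k := t)))) has_real_derivative \<psi>'' (Z \<theta> i ((\<omega>)(k := t))) * c \<theta> i k) (at t)"
      by (rule DERIV_chain2[OF d\<psi>' dZ[OF that]])
    have d2: "((\<lambda>t. \<Prod>j\<in>I - {i}. \<psi> (Z \<theta> j ((\<omega>)(k := t)))) has_real_derivative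
        (\<Sum>j\<in>I - {i}. \<psi>' (Z \<theta> j ((\<omega>)(k := t))) * c \<theta> j k * (\<Prod>l\<in>I - {i} - {j}. \<psi> (Z \<theta> l ((\<omega>)(k := t)))))) (at t)"
      by (rule has_field_derivative_prod) (rule DERIV_chain2[OF d\<psi> dZ[OF that]])
    show ?thesis
      unfolding G_def G'_def using DERIV_mult[OF d1 d2]
      by (rule DERIV_cong) (simp add: sum_distrib_left sum_distrib_right mult_ac)
  qed
  have cG': "continuous_on UNIV (\<lambda>t. G' \<theta> i k ((\<omega>)(k := t)))" if "k \<in> K" for \<theta> i \<omega> k
    unfolding G'_def
    by (intro continuous_intros cZ[OF that]
      continuous_on_compose2[OF c\<psi>(1)] continuous_on_compose2[OF c\<psi>(2)] continuous_on_compose2[OF c\<psi>'']) auto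
  have byparts: "(\<integral>\<omega>. \<omega> k * G \<theta> i \<omega> \<partial>gauss K) = (\<integral>\<omega>. G' \<theta> i k \<omega> \<partial>gauss K)" if "k \<in> K" for \<theta> i k
  proof (rule gauss_coordinate_by_parts[OF fin(2) that])
    let ?C = "\<bar>c \<theta> i k\<bar> * B + (\<Sum>j\<in>I - {i}. \<bar>c \<theta> j k\<bar> * (B * B))"
    have C0: "0 \<le> ?C" using B0 by (auto intro!: add_nonneg_nonneg sum_nonneg)
    show "\<bar>G \<theta> i \<omega>\<bar> \<le> B + ?C" "\<bar>G' \<theta> i k \<omega>\<bar> \<le> B + ?C" for \<omega>
      using G_le[of \<theta> i \<omega>] G'_le[of \<theta> i k \<omega>] C0 B0 by linarith+
  qed (use dG[OF that] cG'[OF that] in auto)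
  have int1: "integrable (gauss K) (\<lambda>\<omega>. \<omega> k * G \<theta> i \<omega>)" if "k \<in> K" for \<theta> i k
    by (rule gauss_integrable_component_mult[OF fin(2) that _ G_le]) measurable
  have int2: "integrable (gauss K) (G' \<theta> i k)" for \<theta> i k
    using G'_le by (intro P.integrable_const_bound[where B = "\<bar>c \<theta> i k\<bar> * B + (\<Sum>j\<in>I - {i}. \<bar>c \<theta> j k\<bar> * (B * B))"] AE_I2) auto
  \<comment> \<open>The derivative \<open>d \<theta>\<close> of \<open>c \<theta>\<close> is correlated with \<open>c \<theta>\<close> only through the difference of covariances.\<close>
  have dc: "(\<Sum>k\<in>K. d \<theta> i k * c \<theta> j k) = sin \<theta> * cos \<theta> * ((\<Sum>k\<in>K. a i k * a j k) - (\<Sum>k\<in>K. b i k * b j k))"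
    if "i \<in> I" "j \<in> I" for \<theta> i j
  proof -
    have "(\<Sum>k\<in>K. d \<theta> i k * c \<theta> j k) = sin \<theta> * cos \<theta> * (\<Sum>k\<in>K. a i k * a j k) - sin \<theta> * cos \<theta> * (\<Sum>k\<in>K. b i k * b j k)
        + cos \<theta> * cos \<theta> * (\<Sum>k\<in>K. a i k * b j k) - sin \<theta> * sin \<theta> * (\<Sum>k\<in>K. a j k * b i k)"
      unfolding sum_distrib_left sum_subtractf[symmetric] sum.distrib[symmetric]
      by (intro sum.cong refl) (simp add: c_def d_def algebra_simps)
    then show ?thesis using orth that by (simp add: algebra_simps)
  qed
  have ED: "0 \<le> (\<integral>\<omega>. D \<theta> \<omega> \<partial>gauss K)" if \<theta>: "0 \<le> \<theta>" "\<theta> \<le> pi / 2" for \<theta>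
  proof -
    have sc: "0 \<le> sin \<theta> * cos \<theta>" using \<theta> by (intro mult_nonneg_nonneg sin_ge_zero cos_ge_zero) auto
    have "(\<integral>\<omega>. D \<theta> \<omega> \<partial>gauss K) = (\<Sum>i\<in>I. \<Sum>k\<in>K. d \<theta> i k * (\<integral>\<omega>. \<omega> k * G \<theta> i \<omega> \<partial>gauss K))"
      unfolding D_def using int1 by (simp add: Bochner_Integration.integral_sum)
    also have "\<dots> = (\<Sum>i\<in>I. \<Sum>k\<in>K. d \<theta> i k * (\<integral>\<omega>. G' \<theta> i k \<omega> \<partial>gauss K))"
      by (intro sum.cong refl) (simp add: byparts)
    also have "\<dots> = (\<Sum>i\<in>I. \<integral>\<omega>. (\<Sum>k\<in>K. d \<theta> i k * G' \<theta> i k \<omega>) \<partial>gauss K)"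
      using int2 by (simp add: Bochner_Integration.integral_sum)
    also have "\<dots> \<ge> 0"
    proof (rule sum_nonneg, rule Bochner_Integration.integral_nonneg)
      fix i \<omega> assume i: "i \<in> I"
      let ?p = "\<lambda>j. \<psi>' (Z \<theta> i \<omega>) * \<psi>' (Z \<theta> j \<omega>) * (\<Prod>l\<in>I - {i} - {j}. \<psi> (Z \<theta> l \<omega>))"
      have "(\<Sum>k\<in>K. d \<theta> i k * G' \<theta> i k \<omega>) =
          (\<Sum>k\<in>K. d \<theta> i k * c \<theta> i k) * (\<psi>'' (Z \<theta> i \<omega>) * (\<Prod>j\<in>I - {i}. \<psi> (Z \<theta> j \<omega>))) +
          (\<Sum>k\<in>K. \<Sum>j\<in>I - {i}. d \<theta> i k * c \<theta> j k * ?p j)"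
        unfolding G'_def distrib_left sum.distrib sum_distrib_right sum_distrib_left by (simp add: mult_ac)
      also have "(\<Sum>k\<in>K. d \<theta> i k * c \<theta> i k) = 0" using dc[OF i i] var[OF i] by simp
      also have "(\<Sum>k\<in>K. \<Sum>j\<in>I - {i}. d \<theta> i k * c \<theta> j k * ?p j) = (\<Sum>j\<in>I - {i}. (\<Sum>k\<in>K. d \<theta> i k * c \<theta> j k) * ?p j)"
        unfolding sum_distrib_right by (rule sum.swap)
      finally have eq: "(\<Sum>k\<in>K. d \<theta> i k * G' \<theta> i k \<omega>) = (\<Sum>j\<in>I - {i}. (\<Sum>k\<in>K. d \<theta> i k * c \<theta> j k) * ?p j)"
        by simp
      show "0 \<le> (\<Sum>k\<in>K. d \<theta> i k * G' \<theta> i k \<omega>)"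
        unfolding eq
      proof (rule sum_nonneg, rule mult_nonneg_nonneg)
        fix j assume j: "j \<in> I - {i}"
        show "0 \<le> (\<Sum>k\<in>K. d \<theta> i k * c \<theta> j k)"
          using dc[OF i, of j] j cov[OF i, of j] sc by simp
        show "0 \<le> ?p j" by (intro mult_nonneg_nonneg mult_nonpos_nonpos mono P0)
      qed
    qed
    finally show ?thesis .
  qed
  have dF: "((\<lambda>\<theta>. F \<theta> \<omega>) has_real_derivative D \<theta> \<omega>) (at \<theta>)" for \<theta> \<omega>
  proof -
    have "((\<lambda>\<theta>. Z \<theta> i \<omega>) has_real_derivative (\<Sum>k\<in>K. d \<theta> i k * \<omega> k)) (at \<theta>)" for i
      unfolding Z_def c_def d_def by (auto intro!: derivative_eq_intros sum.cong simp: algebra_simps)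
    from has_field_derivative_prod[of I, OF DERIV_chain2[OF d\<psi> this]]
    show ?thesis unfolding F_def D_def G_def
      by (rule DERIV_cong) (simp add: sum_distrib_left sum_distrib_right mult_ac)
  qed
  have cD: "continuous_on S (\<lambda>\<theta>. D \<theta> \<omega>)" for \<omega> S
    unfolding D_def G_def Z_def c_def d_def
    by (intro continuous_intros continuous_on_compose2[OF c\<psi>(1)] continuous_on_compose2[OF c\<psi>(2)]) auto
  define f where "f \<theta> \<omega> = D \<theta> \<omega> * indicator {0..pi/2} \<theta>" for \<theta> \<omega>
  have ftc: "(\<integral>\<theta>. f \<theta> \<omega> \<partial>lborel) = F (pi/2) \<omega> - F 0 \<omega>" for \<omega>
    unfolding f_def using cD dF
    by (intro integral_FTC_Icc_real) (auto simp: continuous_on_eq_continuous_within continuous_within_subset intro: continuous_on_interior)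
  \<comment> \<open>An integrable bound for \<open>D \<theta>\<close> that does not depend on \<open>\<theta>\<close> permits exchanging the integrals over \<open>\<theta>\<close> and \<open>\<omega>\<close>.\<close>
  define C where "C = (\<Sum>i\<in>I. \<Sum>k\<in>K. (\<bar>a i k\<bar> + \<bar>b i k\<bar>) * B * (\<integral>\<omega>. \<bar>\<omega> k\<bar> \<partial>gauss K))"
  have Dint: "integrable (gauss K) (D \<theta>)" for \<theta>
    unfolding D_def using int1 by (auto intro!: Bochner_Integration.integrable_sum)
  have Dmeas[measurable]: "(\<lambda>(\<theta>, \<omega>). f \<theta> \<omega>) \<in> borel_measurable (lborel \<Otimes>\<^sub>M gauss K)"
    unfolding f_def D_def G_def Z_def c_def d_def by measurable
  have Dbound: "(\<integral>\<omega>. \<bar>D \<theta> \<omega>\<bar> \<partial>gauss K) \<le> C" for \<theta>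
  proof -
    have dle: "\<bar>d \<theta> i k\<bar> \<le> \<bar>a i k\<bar> + \<bar>b i k\<bar>" for i k
    proof -
      have "\<bar>d \<theta> i k\<bar> \<le> \<bar>cos \<theta> * a i k\<bar> + \<bar>sin \<theta> * b i k\<bar>" unfolding d_def by linarith
      also have "\<dots> \<le> 1 * \<bar>a i k\<bar> + 1 * \<bar>b i k\<bar>" unfolding abs_mult by (intro add_mono mult_right_mono) auto
      finally show ?thesis by simp
    qed
    have I: "integrable (gauss K) (\<lambda>\<omega>. \<Sum>i\<in>I. \<Sum>k\<in>K. (\<bar>a i k\<bar> + \<bar>b i k\<bar>) * B * \<bar>\<omega> k\<bar>)"
      using gauss_integrable_component[OF fin(2)] by (auto intro!: Bochner_Integration.integrable_sum)
    have "(\<integral>\<omega>. \<bar>D \<theta> \<omega>\<bar> \<partial>gauss K) \<le> (\<integral>\<omega>. (\<Sum>i\<in>I. \<Sum>k\<in>K. (\<bar>a i k\<bar> + \<bar>b i k\<bar>) * B * \<bar>\<omega> k\<bar>) \<partial>gauss K)"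
    proof (rule integral_mono[OF integrable_abs[OF Dint] I])
      fix \<omega>
      show "\<bar>D \<theta> \<omega>\<bar> \<le> (\<Sum>i\<in>I. \<Sum>k\<in>K. (\<bar>a i k\<bar> + \<bar>b i k\<bar>) * B * \<bar>\<omega> k\<bar>)"
        unfolding D_def
      proof (intro order_trans[OF sum_abs] sum_mono)
        fix i k
        have "\<bar>d \<theta> i k * (\<omega> k * G \<theta> i \<omega>)\<bar> = \<bar>d \<theta> i k\<bar> * \<bar>G \<theta> i \<omega>\<bar> * \<bar>\<omega> k\<bar>" by (simp add: abs_mult mult_ac)
        also have "\<dots> \<le> (\<bar>a i k\<bar> + \<bar>b i k\<bar>) * B * \<bar>\<omega> k\<bar>"
          by (intro mult_right_mono mult_mono dle G_le) auto
        finally show "\<bar>d \<theta> i k * (\<omega> k * G \<theta> i \<omega>)\<bar> \<le> (\<bar>a i k\<bar> + \<bar>b i k\<bar>) * B * \<bar>\<omega> k\<bar>" .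
      qed
    qed
    also have "\<dots> = C"
      unfolding C_def using gauss_integrable_component[OF fin(2)] by (simp add: Bochner_Integration.integral_sum)
    finally show ?thesis .
  qed
  interpret Q: pair_sigma_finite lborel "gauss K"
    by (intro pair_sigma_finite.intro sigma_finite_lborel P.sigma_finite_measure_axioms)
  have fint: "integrable (lborel \<Otimes>\<^sub>M gauss K) (\<lambda>(\<theta>, \<omega>). f \<theta> \<omega>)"
  proof (rule Q.Fubini_integrable[OF Dmeas])
    show "integrable lborel (\<lambda>\<theta>. \<integral>\<omega>. norm (case (\<theta>, \<omega>) of (\<theta>, \<omega>) \<Rightarrow> f \<theta> \<omega>) \<partial>gauss K)"
    proof (rule Bochner_Integration.integrable_bound)
      show "integrable lborel (\<lambda>\<theta>. C * indicator {0..pi/2} \<theta> :: real)" by simp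
      show "AE \<theta> in lborel. norm (\<integral>\<omega>. norm (case (\<theta>, \<omega>) of (\<theta>, \<omega>) \<Rightarrow> f \<theta> \<omega>) \<partial>gauss K) \<le> norm (C * indicator {0..pi/2} \<theta> :: real)"
        using Dbound by (intro AE_I2) (auto simp: f_def indicator_def intro: order_trans[OF _ abs_ge_self])
    qed measurable
    show "AE \<theta> in lborel. integrable (gauss K) (\<lambda>\<omega>. case (\<theta>, \<omega>) of (\<theta>, \<omega>) \<Rightarrow> f \<theta> \<omega>)"
      using Dint by (auto simp: f_def)
  qed
  have Fint: "integrable (gauss K) (F \<theta>)" for \<theta>
    using P1 unfolding F_def by (intro P.integrable_const_bound[where B = 1]) auto
  have "0 \<le> (\<integral>\<theta>. (\<integral>\<omega>. f \<theta> \<omega> \<partial>gauss K) \<partial>lborel)"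
    by (rule Bochner_Integration.integral_nonneg) (use ED in \<open>auto simp: f_def indicator_def\<close>)
  also have "\<dots> = (\<integral>\<omega>. (\<integral>\<theta>. f \<theta> \<omega> \<partial>lborel) \<partial>gauss K)"
    by (rule Q.Fubini_integral[OF fint, symmetric])
  also have "\<dots> = (\<integral>\<omega>. F (pi/2) \<omega> \<partial>gauss K) - (\<integral>\<omega>. F 0 \<omega> \<partial>gauss K)"
    unfolding ftc by (rule Bochner_Integration.integral_diff[OF Fint Fint])
  finally show ?thesis by (simp add: F_def Z_def c_def)
qed

section \<open>Exponential moments of Gaussian maxima\<close>

text \<open>
  The cutoff is \<open>\<psi> z = exp (- s * exp z)\<close>: a product of such factors is
  the Laplace kernel of the exponential sum, which a mixture over \<open>s\<close> converts into powers.
\<close>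

lemma slepian_gumbel:
  fixes a b :: "'i \<Rightarrow> 'k \<Rightarrow> real"
  assumes fin: "finite I" "finite K" and s: "0 < s"
    and orth: "\<And>i j. i \<in> I \<Longrightarrow> j \<in> I \<Longrightarrow> (\<Sum>k\<in>K. a i k * b j k) = 0"
    and var: "\<And>i. i \<in> I \<Longrightarrow> (\<Sum>k\<in>K. a i k * a i k) = (\<Sum>k\<in>K. b i k * b i k)"
    and cov: "\<And>i j. i \<in> I \<Longrightarrow> j \<in> I \<Longrightarrow> (\<Sum>k\<in>K. b i k * b j k) \<le> (\<Sum>k\<in>K. a i k * a j k)"
  shows "(\<integral>\<omega>. exp (- (s * (\<Sum>i\<in>I. exp (\<Sum>k\<in>K. b i k * \<omega> k)))) \<partial>gauss K) \<le>
    (\<integral>\<omega>. exp (- (s * (\<Sum>i\<in>I. exp (\<Sum>k\<in>K. a i k * \<omega> k)))) \<partial>gauss K)"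
proof -
  have bd1: "x * exp (- x) \<le> 1" if "0 \<le> x" for x :: real
  proof -
    have "x \<le> exp x" using exp_ge_add_one_self[of x] by linarith
    then show ?thesis by (simp add: exp_minus field_simps)
  qed
  have bd2: "x\<^sup>2 * exp (- x) \<le> 2" if "0 \<le> x" for x :: real
    using exp_lower_Taylor_quadratic[OF that] that by (simp add: exp_minus field_simps)
  have "(\<integral>\<omega>. (\<Prod>i\<in>I. exp (- (s * exp (\<Sum>k\<in>K. b i k * \<omega> k)))) \<partial>gauss K) \<le>
    (\<integral>\<omega>. (\<Prod>i\<in>I. exp (- (s * exp (\<Sum>k\<in>K. a i k * \<omega> k)))) \<partial>gauss K)"
  proof (rule slepian_smooth[where B = 3, OF fin _ _ _ _ _ _ _ _ orth var cov])
    show "((\<lambda>z. exp (- (s * exp z))) has_real_derivative - (s * exp z * exp (- (s * exp z)))) (at z)" for z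
      by (auto intro!: derivative_eq_intros)
    show "((\<lambda>z. - (s * exp z * exp (- (s * exp z)))) has_real_derivative
        ((s * exp z)\<^sup>2 * exp (- (s * exp z)) - s * exp z * exp (- (s * exp z)))) (at z)" for z
      by (auto intro!: derivative_eq_intros simp: power2_eq_square algebra_simps)
    show "\<bar>- (s * exp z * exp (- (s * exp z)))\<bar> \<le> 3" for z
      using bd1[of "s * exp z"] s by simp
    show "\<bar>(s * exp z)\<^sup>2 * exp (- (s * exp z)) - s * exp z * exp (- (s * exp z))\<bar> \<le> 3" for z
    proof -
      have "0 \<le> (s * exp z)\<^sup>2 * exp (- (s * exp z))" "0 \<le> s * exp z * exp (- (s * exp z))"
        using s by auto
      moreover have "(s * exp z)\<^sup>2 * exp (- (s * exp z)) \<le> 2" "s * exp z * exp (- (s * exp z)) \<le> 1"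
        using s by (intro bd1 bd2; simp)+
      ultimately show ?thesis by linarith
    qed
  qed (use s in \<open>auto intro!: continuous_intros\<close>)
  then show ?thesis
    by (simp add: exp_sum[OF fin(1)] sum_distrib_left sum_negf[symmetric])
qed

text \<open>
  With \<open>r = exp (- v)\<close> this is the integral of \<open>(1 - exp (- r)) * r powr (- 1 - p)\<close> over \<open>r > 0\<close>, the
  normalising constant that represents \<open>S powr p\<close>, for \<open>0 < p < 1\<close>, as a mixture of the functions
  \<open>1 - exp (- r * S)\<close>. In the variable \<open>v\<close>, rescaling \<open>S\<close> is a translation.
\<close>

definition power_mixture_const :: "real \<Rightarrow> ennreal" where
  "power_mixture_const p = (\<integral>\<^sup>+v. ennreal ((1 - exp (- exp (- v))) * exp (p * v)) \<partial>lborel)"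

lemma power_mixture:
  assumes "0 < S"
  shows "(\<integral>\<^sup>+v. ennreal ((1 - exp (- (exp (- v) * S))) * exp (p * v)) \<partial>lborel) =
    ennreal (S powr p) * power_mixture_const p"
proof -
  have "(\<integral>\<^sup>+v. ennreal ((1 - exp (- (exp (- v) * S))) * exp (p * v)) \<partial>lborel) =
      (\<integral>\<^sup>+v. ennreal ((1 - exp (- (exp (- (ln S + 1 * v)) * S))) * exp (p * (ln S + 1 * v))) \<partial>lborel)"
    using nn_integral_real_affine[of "\<lambda>v. ennreal ((1 - exp (- (exp (- v) * S))) * exp (p * v))" 1 "ln S"] by simp
  also have "\<dots> = (\<integral>\<^sup>+v. ennreal (S powr p) * ennreal ((1 - exp (- exp (- v))) * exp (p * v)) \<partial>lborel)"
  proof (rule nn_integral_cong)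
    fix v :: real
    have "exp (- (ln S + 1 * v)) * S = exp (- v)" "exp (p * (ln S + 1 * v)) = S powr p * exp (p * v)"
      using assms by (simp_all add: powr_def exp_add exp_diff exp_minus distrib_left field_simps)
    then show "ennreal ((1 - exp (- (exp (- (ln S + 1 * v)) * S))) * exp (p * (ln S + 1 * v))) =
        ennreal (S powr p) * ennreal ((1 - exp (- exp (- v))) * exp (p * v))"
      by (subst ennreal_mult[symmetric]) (simp_all add: mult_ac)
  qed
  also have "\<dots> = ennreal (S powr p) * power_mixture_const p"
    unfolding power_mixture_const_def by (rule nn_integral_cmult) auto
  finally show ?thesis .
qed

lemma power_mixture_const_pos: "0 < power_mixture_const p"
proof -
  have "0 < ennreal ((1 - exp (- exp (- 1))) * exp (- \<bar>p\<bar>))" by simp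
  also have "\<dots> = (\<integral>\<^sup>+v. ennreal ((1 - exp (- exp (- 1))) * exp (- \<bar>p\<bar>)) * indicator {0..1::real} v \<partial>lborel)"
    by (simp add: nn_integral_cmult_indicator)
  also have "\<dots> \<le> power_mixture_const p"
    unfolding power_mixture_const_def
  proof (rule nn_integral_mono)
    fix v :: real
    have "- \<bar>p\<bar> \<le> p * v" if "0 \<le> v" "v \<le> 1"
    proof -
      have "\<bar>p * v\<bar> \<le> \<bar>p\<bar>" using that by (simp add: abs_mult mult_left_le)
      then show ?thesis by linarith
    qed
    then show "ennreal ((1 - exp (- exp (- 1))) * exp (- \<bar>p\<bar>)) * indicator {0..1} v \<le> ennreal ((1 - exp (- exp (- v))) * exp (p * v))"
      by (auto simp: indicator_def intro!: ennreal_leI mult_mono)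
  qed
  finally show ?thesis .
qed

text \<open>
  The factor \<open>1 - exp (- exp (- v))\<close> is at most \<open>1\<close> and at most \<open>exp (- v)\<close>. The first bound gives
  integrability at \<open>-\<infinity>\<close> because \<open>p > 0\<close>, the second at \<open>\<infinity>\<close> because \<open>p < 1\<close>.
\<close>

lemma power_mixture_const_finite:
  assumes p: "0 < p" "p < 1"
  shows "power_mixture_const p < \<infinity>"
proof -
  have E: "(\<integral>\<^sup>+v. ennreal (exp (- (q * v))) * indicator {0..} v \<partial>lborel) = ennreal (1 / q)" if "0 < q" for q :: real
  proof -
    have "(\<integral>\<^sup>+v. ennreal (exp (- (q * v))) * indicator {0..} v \<partial>lborel) = ennreal (0 - - exp (- (q * 0)) / q)"
    proof (rule nn_integral_FTC_atLeast)
      show "((\<lambda>v. - exp (- (q * v)) / q) has_real_derivative exp (- (q * v))) (at v)" for v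
        using that by (auto intro!: derivative_eq_intros)
      show "((\<lambda>v. - exp (- (q * v)) / q) \<longlongrightarrow> 0) at_top"
        using that by real_asymp
    qed auto
    then show ?thesis by simp
  qed
  have "power_mixture_const p \<le> (\<integral>\<^sup>+v. (ennreal (exp (p * v)) * indicator {..0} v + ennreal (exp (- ((1 - p) * v))) * indicator {0..} v) \<partial>lborel)"
    unfolding power_mixture_const_def
  proof (rule nn_integral_mono)
    fix v :: real
    have "1 - exp (- exp (- v)) \<le> exp (- v)" using exp_ge_add_one_self[of "- exp (- v)"] by linarith
    then have 1: "(1 - exp (- exp (- v))) * exp (p * v) \<le> exp (- ((1 - p) * v))"
      using mult_right_mono[of "1 - exp (- exp (- v))" "exp (- v)" "exp (p * v)"]
      by (simp add: exp_add[symmetric] algebra_simps)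
    have 2: "(1 - exp (- exp (- v))) * exp (p * v) \<le> exp (p * v)"
      by simp
    show "ennreal ((1 - exp (- exp (- v))) * exp (p * v)) \<le>
        ennreal (exp (p * v)) * indicator {..0} v + ennreal (exp (- ((1 - p) * v))) * indicator {0..} v"
    proof (cases "v \<le> 0")
      case True
      then show ?thesis using order_trans[OF ennreal_leI[OF 2]] by (simp add: add_increasing2)
    next
      case False
      then show ?thesis using ennreal_leI[OF 1] by simp
    qed
  qed
  also have "\<dots> = (\<integral>\<^sup>+v. ennreal (exp (p * v)) * indicator {..0} v \<partial>lborel) +
      (\<integral>\<^sup>+v. ennreal (exp (- ((1 - p) * v))) * indicator {0..} v \<partial>lborel)"
    by (rule nn_integral_add) auto
  also have "(\<integral>\<^sup>+v. ennreal (exp (p * v)) * indicator {..0} v \<partial>lborel) = (\<integral>\<^sup>+v. ennreal (exp (- (p * v))) * indicator {0..} v \<partial>lborel)"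
    using nn_integral_real_affine[of "\<lambda>v. ennreal (exp (p * v)) * indicator {..0} v" "-1" 0]
    by (simp add: indicator_def)
  also have "\<dots> + (\<integral>\<^sup>+v. ennreal (exp (- ((1 - p) * v))) * indicator {0..} v \<partial>lborel) < \<infinity>"
    using p by (simp add: E)
  finally show ?thesis .
qed

text \<open>
  Averaging the inequality for \<open>1 - exp (- r * S)\<close> over \<open>r\<close> with the weights of the mixture gives it for
  \<open>S powr p\<close>.
\<close>

lemma slepian_power:
  fixes a b :: "'i \<Rightarrow> 'k \<Rightarrow> real"
  assumes fin: "finite I" "I \<noteq> {}" "finite K" and p: "0 < p" "p < 1"
    and orth: "\<And>i j. i \<in> I \<Longrightarrow> j \<in> I \<Longrightarrow> (\<Sum>k\<in>K. a i k * b j k) = 0"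
    and var: "\<And>i. i \<in> I \<Longrightarrow> (\<Sum>k\<in>K. a i k * a i k) = (\<Sum>k\<in>K. b i k * b i k)"
    and cov: "\<And>i j. i \<in> I \<Longrightarrow> j \<in> I \<Longrightarrow> (\<Sum>k\<in>K. b i k * b j k) \<le> (\<Sum>k\<in>K. a i k * a j k)"
  shows "(\<integral>\<^sup>+\<omega>. ennreal ((\<Sum>i\<in>I. exp (\<Sum>k\<in>K. a i k * \<omega> k)) powr p) \<partial>gauss K) \<le>
    (\<integral>\<^sup>+\<omega>. ennreal ((\<Sum>i\<in>I. exp (\<Sum>k\<in>K. b i k * \<omega> k)) powr p) \<partial>gauss K)"
proof -
  interpret P: prob_space "gauss K" by (rule prob_space_gauss)
  interpret Q: pair_sigma_finite "gauss K" lborel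
    by (intro pair_sigma_finite.intro sigma_finite_lborel P.sigma_finite_measure_axioms)
  let ?S = "\<lambda>c \<omega>. \<Sum>i\<in>I. exp (\<Sum>k\<in>K. c i k * \<omega> k)"
  have pos: "0 < ?S c \<omega>" for c :: "'i \<Rightarrow> 'k \<Rightarrow> real" and \<omega> using fin by (intro sum_pos) auto
  have mix: "(\<integral>\<^sup>+\<omega>. ennreal (?S c \<omega> powr p) \<partial>gauss K) * power_mixture_const p =
      (\<integral>\<^sup>+v. ennreal ((1 - (\<integral>\<omega>. exp (- (exp (- v) * ?S c \<omega>)) \<partial>gauss K)) * exp (p * v)) \<partial>lborel)"
    for c :: "'i \<Rightarrow> 'k \<Rightarrow> real"
  proof -
    have inner: "(\<integral>\<^sup>+\<omega>. ennreal ((1 - exp (- (exp (- v) * ?S c \<omega>))) * exp (p * v)) \<partial>gauss K) =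
        ennreal ((1 - (\<integral>\<omega>. exp (- (exp (- v) * ?S c \<omega>)) \<partial>gauss K)) * exp (p * v))" for v
    proof -
      have le1: "exp (- (exp (- v) * ?S c \<omega>)) \<le> 1" for \<omega> using pos[of c \<omega>] by simp
      have int: "integrable (gauss K) (\<lambda>\<omega>. exp (- (exp (- v) * ?S c \<omega>)))"
        using le1 by (intro P.integrable_const_bound[where B = 1]) auto
      have "(\<integral>\<^sup>+\<omega>. ennreal ((1 - exp (- (exp (- v) * ?S c \<omega>))) * exp (p * v)) \<partial>gauss K) =
          ennreal (\<integral>\<omega>. (1 - exp (- (exp (- v) * ?S c \<omega>))) * exp (p * v) \<partial>gauss K)"
        using int le1 by (intro nn_integral_eq_integral integrable_mult_left Bochner_Integration.integrable_diff) auto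
      also have "(\<integral>\<omega>. (1 - exp (- (exp (- v) * ?S c \<omega>))) * exp (p * v) \<partial>gauss K) =
          (1 - (\<integral>\<omega>. exp (- (exp (- v) * ?S c \<omega>)) \<partial>gauss K)) * exp (p * v)"
        using int by (simp add: P.prob_space)
      finally show ?thesis .
    qed
    have "(\<integral>\<^sup>+\<omega>. ennreal (?S c \<omega> powr p) \<partial>gauss K) * power_mixture_const p =
        (\<integral>\<^sup>+\<omega>. ennreal (?S c \<omega> powr p) * power_mixture_const p \<partial>gauss K)"
      by (rule nn_integral_multc[symmetric]) measurable
    also have "\<dots> = (\<integral>\<^sup>+\<omega>. (\<integral>\<^sup>+v. ennreal ((1 - exp (- (exp (- v) * ?S c \<omega>))) * exp (p * v)) \<partial>lborel) \<partial>gauss K)"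
      by (intro nn_integral_cong power_mixture[symmetric] pos)
    also have "\<dots> = (\<integral>\<^sup>+v. (\<integral>\<^sup>+\<omega>. ennreal ((1 - exp (- (exp (- v) * ?S c \<omega>))) * exp (p * v)) \<partial>gauss K) \<partial>lborel)"
      by (rule Q.Fubini'[symmetric]) measurable
    finally show ?thesis unfolding inner .
  qed
  have "(\<integral>\<^sup>+\<omega>. ennreal (?S a \<omega> powr p) \<partial>gauss K) * power_mixture_const p \<le>
      (\<integral>\<^sup>+\<omega>. ennreal (?S b \<omega> powr p) \<partial>gauss K) * power_mixture_const p"
    unfolding mix
    by (intro nn_integral_mono ennreal_leI mult_right_mono diff_left_mono
      slepian_gumbel[OF fin(1,3) _ orth var cov]) auto
  moreover have "power_mixture_const p \<noteq> 0" "power_mixture_const p \<noteq> top"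
    using power_mixture_const_pos[of p] power_mixture_const_finite[OF p] by auto
  ultimately show ?thesis
    by (simp only: mult.commute[of _ "power_mixture_const p"] ennreal_mult_le_mult_iff not_False_eq_True)
qed

text \<open>
  Apply \<open>slepian_power\<close> to the processes scaled by \<open>l / p\<close>: the power \<open>p\<close> of their exponential sum lies
  between \<open>exp (l * Max)\<close> and \<open>card I powr p * exp (l * Max)\<close>, and the factor \<open>card I powr p\<close> tends to \<open>1\<close>
  as \<open>p\<close> tends to \<open>0\<close>.
\<close>

theorem gaussian_comparison_exp_Max:
  fixes a b :: "'i \<Rightarrow> 'k \<Rightarrow> real"
  assumes fin: "finite I" "I \<noteq> {}" "finite K" and l: "0 < l"
    and orth: "\<And>i j. i \<in> I \<Longrightarrow> j \<in> I \<Longrightarrow> (\<Sum>k\<in>K. a i k * b j k) = 0"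
    and var: "\<And>i. i \<in> I \<Longrightarrow> (\<Sum>k\<in>K. a i k * a i k) = (\<Sum>k\<in>K. b i k * b i k)"
    and cov: "\<And>i j. i \<in> I \<Longrightarrow> j \<in> I \<Longrightarrow> (\<Sum>k\<in>K. b i k * b j k) \<le> (\<Sum>k\<in>K. a i k * a j k)"
  shows "(\<integral>\<^sup>+\<omega>. ennreal (exp (l * Max ((\<lambda>i. \<Sum>k\<in>K. a i k * \<omega> k) ` I))) \<partial>gauss K) \<le>
    (\<integral>\<^sup>+\<omega>. ennreal (exp (l * Max ((\<lambda>i. \<Sum>k\<in>K. b i k * \<omega> k) ` I))) \<partial>gauss K)" (is "?A \<le> ?B")
proof (cases "?B = \<infinity>")
  case False
  then obtain B where B: "?B = ennreal B" "0 \<le> B" by (cases ?B) auto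
  let ?N = "real (card I)"
  have N: "0 < ?N" using fin by (simp add: card_gt_0_iff)
  have le: "?A \<le> ennreal (?N powr p * B)" if p: "0 < p" "p < 1" for p
  proof -
    let ?X = "\<lambda>c \<omega> i. \<Sum>k\<in>K. c i k * \<omega> k"
    let ?S = "\<lambda>c \<omega>. \<Sum>i\<in>I. exp (\<Sum>k\<in>K. (l / p * c i k) * \<omega> k)"
    have S: "?S c \<omega> = (\<Sum>i\<in>I. exp (l / p * ?X c \<omega> i))" for c :: "'i \<Rightarrow> 'k \<Rightarrow> real" and \<omega>
      by (simp add: sum_distrib_left mult.assoc)
    have exp_powr: "exp (l / p * x) powr p = exp (l * x)" for x
      using p by (simp add: powr_def)
    have scale: "(\<Sum>k\<in>K. l / p * x k * (l / p * y k)) = (l / p)\<^sup>2 * (\<Sum>k\<in>K. x k * y k)" for x y :: "'k \<Rightarrow> real"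
      by (simp add: sum_distrib_left power2_eq_square mult_ac)
    have "?A \<le> (\<integral>\<^sup>+\<omega>. ennreal (?S a \<omega> powr p) \<partial>gauss K)"
    proof (intro nn_integral_mono ennreal_leI)
      fix \<omega> :: "'k \<Rightarrow> real"
      have "Max (?X a \<omega> ` I) \<in> ?X a \<omega> ` I" using fin by (intro Max_in) auto
      then obtain i where i: "i \<in> I" "Max (?X a \<omega> ` I) = ?X a \<omega> i" by auto
      have "exp (l * ?X a \<omega> i) = exp (l / p * ?X a \<omega> i) powr p" by (rule exp_powr[symmetric])
      also have "\<dots> \<le> ?S a \<omega> powr p"
        unfolding S using p fin i(1) by (intro powr_mono2 member_le_sum) auto
      finally show "exp (l * Max (?X a \<omega> ` I)) \<le> ?S a \<omega> powr p" using i by simp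
    qed
    also have "\<dots> \<le> (\<integral>\<^sup>+\<omega>. ennreal (?S b \<omega> powr p) \<partial>gauss K)"
      using orth var cov by (intro slepian_power fin p) (simp_all only: scale mult_zero_right mult_left_mono zero_le_power2)
    also have "\<dots> \<le> (\<integral>\<^sup>+\<omega>. ennreal (?N powr p) * ennreal (exp (l * Max (?X b \<omega> ` I))) \<partial>gauss K)"
      unfolding ennreal_mult[OF powr_ge_zero exp_ge_zero, symmetric]
    proof (intro nn_integral_mono ennreal_leI)
      fix \<omega> :: "'k \<Rightarrow> real"
      let ?m = "Max (?X b \<omega> ` I)"
      have "?S b \<omega> \<le> (\<Sum>i\<in>I. exp (l / p * ?m))"
        unfolding S using p l fin by (intro sum_mono) (auto intro!: divide_right_mono mult_left_mono Max_ge)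
      also have "\<dots> = ?N * exp (l / p * ?m)" by simp
      finally have "?S b \<omega> powr p \<le> (?N * exp (l / p * ?m)) powr p"
        using p by (intro powr_mono2 sum_nonneg) auto
      also have "\<dots> = ?N powr p * exp (l * ?m)"
        using exp_powr[of ?m] by (simp add: powr_mult)
      finally show "?S b \<omega> powr p \<le> ?N powr p * exp (l * ?m)" .
    qed
    also have "\<dots> = ennreal (?N powr p) * ?B"
      using fin by (intro nn_integral_cmult) measurable
    also have "\<dots> = ennreal (?N powr p * B)" using B by (simp add: ennreal_mult)
    finally show ?thesis .
  qed
  have "((\<lambda>p. ?N powr p * B) \<longlongrightarrow> ?N powr 0 * B) (at_right 0)"
    using N by (intro tendsto_intros) auto
  then have "((\<lambda>p. ennreal (?N powr p * B)) \<longlongrightarrow> ennreal (?N powr 0 * B)) (at_right 0)"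
    by (rule tendsto_ennrealI)
  then have "?A \<le> ennreal (?N powr 0 * B)"
  proof (rule tendsto_lowerbound)
    show "\<forall>\<^sub>F p in at_right 0. ?A \<le> ennreal (?N powr p * B)"
      using eventually_at_right_less[of 0] le by (auto simp: eventually_at_right_field intro!: exI[of _ 1])
  qed simp
  then show ?thesis using N B by simp
qed simp

section \<open>Gordon's comparison for the maximum over the cube\<close>

text \<open>
  All Gaussian variables of the comparison are placed in one \<open>(m + 1) \<times> (n + 1)\<close> array: the block of
  indices \<open>i < m\<close>, \<open>j < n\<close> holds the matrix, the last column the vector \<open>g\<close>, the last row the vector
  \<open>h\<close>, and the corner the scalar \<open>\<gamma>\<close>.
\<close>

lemma (in comm_monoid_set) bordered_grid:
  fixes m n :: nat
  shows "F g ({..m} \<times> {..n}) = f (f (F (\<lambda>i. F (\<lambda>j. g (i, j)) {..<n}) {..<m}) (F (\<lambda>i. g (i, n)) {..<m}))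
      (f (F (\<lambda>j. g (m, j)) {..<n}) (g (m, n)))"
proof -
  have "F g ({..m} \<times> {..n}) = F (\<lambda>i. F (\<lambda>j. g (i, j)) {..n}) {..m}"
    by (simp add: cartesian_product)
  also have "\<dots> = f (f (F (\<lambda>i. F (\<lambda>j. g (i, j)) {..<n}) {..<m}) (F (\<lambda>i. g (i, n)) {..<m}))
      (f (F (\<lambda>j. g (m, j)) {..<n}) (g (m, n)))"
    by (simp add: lessThan_Suc_atMost[symmetric] lessThan_Suc distrib ac_simps)
  finally show ?thesis .
qed

text \<open>
  Cut the cube \<open>[-1, 1]\<^sup>m\<close> into cells of side \<open>1 / N\<close> and choose one unit vector from each cell that
  contains one. Moving a unit vector to the representative of its cell changes its inner product with
  \<open>v\<close> by at most \<open>m / N\<close> times the norm of \<open>v\<close>; apply this to the unit vector in the direction of \<open>v\<close>.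
\<close>

lemma sphere_net:
  fixes m :: nat and \<epsilon> :: real
  assumes m: "0 < m" and \<epsilon>: "0 < \<epsilon>"
  obtains T :: "(nat \<Rightarrow> real) set" where "finite T" "T \<noteq> {}" "\<And>y. y \<in> T \<Longrightarrow> (\<Sum>i<m. (y i)\<^sup>2) = 1"
    "\<And>v. \<exists>y\<in>T. (1 - \<epsilon>) * L2_set v {..<m} \<le> (\<Sum>i<m. y i * v i)"
proof -
  define S where "S = {y :: nat \<Rightarrow> real. (\<Sum>i<m. (y i)\<^sup>2) = 1}"
  obtain N :: nat where N: "real m / \<epsilon> < real N" using reals_Archimedean2 by blast
  then have N0: "0 < real N" using m \<epsilon> by (smt (verit) divide_pos_pos of_nat_0_less_iff)
  have mN: "real m / real N \<le> \<epsilon>" using N N0 \<epsilon> by (simp add: field_simps)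
  define cell where "cell y = restrict (\<lambda>i. \<lfloor>real N * y i\<rfloor>) {..<m}" for y :: "nat \<Rightarrow> real"
  define T where "T = (\<lambda>c. SOME y. y \<in> S \<and> cell y = c) ` (cell ` S)"
  have coord: "\<bar>y i\<bar> \<le> 1" if "y \<in> S" "i < m" for y i
  proof -
    have "(y i)\<^sup>2 \<le> (\<Sum>i<m. (y i)\<^sup>2)" using that by (intro member_le_sum) auto
    then show ?thesis using that by (simp add: S_def abs_square_le_1)
  qed
  have "cell ` S \<subseteq> (\<Pi>\<^sub>E i\<in>{..<m}. {- int N..int N})"
  proof (intro image_subsetI)
    fix y assume y: "y \<in> S"
    have "- int N \<le> \<lfloor>real N * y i\<rfloor> \<and> \<lfloor>real N * y i\<rfloor> \<le> int N" if "i < m" for i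
    proof -
      have "\<bar>real N * y i\<bar> \<le> real N * 1" unfolding abs_mult using coord[OF y that] N0 by (intro mult_mono) auto
      then show ?thesis by (simp add: le_floor_iff) linarith
    qed
    then show "cell y \<in> (\<Pi>\<^sub>E i\<in>{..<m}. {- int N..int N})" by (auto simp: cell_def)
  qed
  then have finC: "finite (cell ` S)" by (rule finite_subset) (auto intro: finite_PiE)
  have pick: "\<exists>y\<in>T. y \<in> S \<and> cell y = cell u" if "u \<in> S" for u
  proof -
    have "(SOME y. y \<in> S \<and> cell y = cell u) \<in> S \<and> cell (SOME y. y \<in> S \<and> cell y = cell u) = cell u"
      using that by (intro someI[of "\<lambda>y. y \<in> S \<and> cell y = cell u" u]) auto
    then show ?thesis using that unfolding T_def by blast
  qed
  have TS: "y \<in> S" if "y \<in> T" for y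
  proof -
    obtain u where "u \<in> S" "y = (SOME y. y \<in> S \<and> cell y = cell u)" using \<open>y \<in> T\<close> unfolding T_def by auto
    then show ?thesis using someI[of "\<lambda>y. y \<in> S \<and> cell y = cell u" u] by auto
  qed
  have "(\<lambda>i. if i = 0 then 1 else 0 :: real) \<in> S"
    using m by (simp add: S_def if_distrib[of "\<lambda>x. x\<^sup>2"] sum.delta cong: if_cong)
  then have T_ne: "T \<noteq> {}" unfolding T_def by auto
  have near: "\<exists>y\<in>T. (1 - \<epsilon>) * L2_set v {..<m} \<le> (\<Sum>i<m. y i * v i)" for v
  proof (cases "L2_set v {..<m} = 0")
    case True
    then have "\<forall>i\<in>{..<m}. v i = 0" by (simp add: L2_set_eq_0_iff)
    then show ?thesis using T_ne True by auto
  next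
    case False
    define r where "r = L2_set v {..<m}"
    have r: "0 < r" "r\<^sup>2 = (\<Sum>i<m. (v i)\<^sup>2)"
      using False L2_set_nonneg[of v "{..<m}"] by (auto simp: r_def L2_set_def sum_nonneg order_less_le)
    define w where "w i = v i / r" for i
    have "(\<Sum>i<m. (w i)\<^sup>2) = (\<Sum>i<m. (v i)\<^sup>2) / r\<^sup>2"
      by (simp add: w_def power_divide sum_divide_distrib)
    then have "w \<in> S" using r(1) by (simp add: S_def flip: r(2))
    then obtain y where y: "y \<in> T" "cell y = cell w" using pick by blast
    have close: "\<bar>w i - y i\<bar> \<le> 1 / real N" if "i < m" for i
    proof -
      have "\<lfloor>real N * y i\<rfloor> = \<lfloor>real N * w i\<rfloor>" using fun_cong[OF y(2), of i] that by (simp add: cell_def)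
      then have "\<bar>real N * w i - real N * y i\<bar> \<le> 1" by linarith
      then have "\<bar>real N * (w i - y i)\<bar> \<le> 1" by (simp only: right_diff_distrib)
      then have "real N * \<bar>w i - y i\<bar> \<le> 1" by (simp only: abs_mult abs_of_nat)
      then show ?thesis using N0 by (simp add: field_simps)
    qed
    have v_le: "\<bar>v i\<bar> \<le> r" if "i < m" for i
      using member_le_L2_set[of "{..<m}" i "\<lambda>i. \<bar>v i\<bar>"] that by (simp add: r_def L2_set_def)
    have "(\<Sum>i<m. w i * v i) = r"
    proof -
      have "(\<Sum>i<m. w i * v i) = (\<Sum>i<m. (v i)\<^sup>2) / r"
        by (simp add: w_def sum_divide_distrib power2_eq_square)
      also have "\<dots> = r\<^sup>2 / r" by (simp only: r(2))
      also have "\<dots> = r" using r(1) by (simp add: power2_eq_square)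
      finally show ?thesis .
    qed
    moreover have "(\<Sum>i<m. (w i - y i) * v i) \<le> \<epsilon> * r"
    proof -
      have "(\<Sum>i<m. (w i - y i) * v i) \<le> (\<Sum>i<m. 1 / real N * r)"
      proof (rule sum_mono)
        fix i assume "i \<in> {..<m}"
        then have "\<bar>(w i - y i) * v i\<bar> \<le> 1 / real N * r"
          unfolding abs_mult using close v_le by (intro mult_mono) auto
        then show "(w i - y i) * v i \<le> 1 / real N * r" by linarith
      qed
      also have "\<dots> = real m / real N * r" by simp
      also have "\<dots> \<le> \<epsilon> * r" using mN r by (intro mult_right_mono) auto
      finally show ?thesis .
    qed
    ultimately have "(1 - \<epsilon>) * r \<le> (\<Sum>i<m. y i * v i)"
      by (simp add: left_diff_distrib sum_subtractf)
    then show ?thesis using y(1) by (auto simp: r_def)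
  qed
  show thesis
  proof (rule that)
    show "finite T" using finC by (simp add: T_def)
    show "(\<Sum>i<m. (y i)\<^sup>2) = 1" if "y \<in> T" for y using TS[OF that] by (simp add: S_def)
  qed (rule T_ne near)+
qed

lemma finite_scaled_cube: "finite (scaled_cube n)"
  unfolding scaled_cube_def by (intro finite_PiE) auto

lemma scaled_cube_nonempty: "scaled_cube n \<noteq> {}"
  unfolding scaled_cube_def by (simp add: PiE_eq_empty_iff)

lemma scaled_cube_abs: "x \<in> scaled_cube n \<Longrightarrow> j < n \<Longrightarrow> \<bar>x j\<bar> = 1 / sqrt (real n)"
  unfolding scaled_cube_def by (drule PiE_mem[of _ _ _ j]) auto

lemma scaled_cube_unit:
  assumes "x \<in> scaled_cube n" "0 < n"
  shows "(\<Sum>j<n. (x j)\<^sup>2) = 1"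
proof -
  have "(\<Sum>j<n. (x j)\<^sup>2) = (\<Sum>j<n. 1 / real n)"
    using scaled_cube_abs[OF assms(1)]
    by (intro sum.cong refl) (metis lessThan_iff power2_abs power_one_over real_sqrt_pow2 of_nat_0_le_iff)
  then show ?thesis using assms by simp
qed

lemma inner_unit_le_1:
  fixes x x' :: "'a \<Rightarrow> real"
  assumes "(\<Sum>i\<in>A. (x i)\<^sup>2) = 1" "(\<Sum>i\<in>A. (x' i)\<^sup>2) = 1"
  shows "(\<Sum>i\<in>A. x i * x' i) \<le> 1"
proof -
  have "0 \<le> (\<Sum>i\<in>A. (x i - x' i)\<^sup>2)" by (simp add: sum_nonneg)
  also have "\<dots> = 2 - 2 * (\<Sum>i\<in>A. x i * x' i)"
    using assms by (simp add: power2_diff sum.distrib sum_subtractf sum_distrib_left mult.assoc)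
  finally show ?thesis by simp
qed

text \<open>
  Coefficient arrays of the processes \<open>\<langle>y, H x\<rangle> + \<gamma>\<close> and \<open>\<langle>y, g\<rangle> + \<langle>x, h\<rangle>\<close> at the index \<open>(x, y)\<close>, in the
  bordered array of Gaussian variables.
\<close>

definition gordon_process :: "nat \<Rightarrow> nat \<Rightarrow> (nat \<Rightarrow> real) \<times> (nat \<Rightarrow> real) \<Rightarrow> nat \<times> nat \<Rightarrow> real" where
  "gordon_process m n = (\<lambda>(x, y) (i, j).
     if i < m \<and> j < n then y i * x j else if i = m \<and> j = n then 1 else 0)"

definition decoupled_process :: "nat \<Rightarrow> nat \<Rightarrow> (nat \<Rightarrow> real) \<times> (nat \<Rightarrow> real) \<Rightarrow> nat \<times> nat \<Rightarrow> real" where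
  "decoupled_process m n = (\<lambda>(x, y) (i, j).
     if i < m \<and> j = n then y i else if i = m \<and> j < n then x j else 0)"

lemma gordon_process_value:
  "(\<Sum>k\<in>{..m} \<times> {..n}. gordon_process m n (x, y) k * \<omega> k) =
    (\<Sum>i<m. y i * mat_vec n (\<lambda>i j. \<omega> (i, j)) x i) + \<omega> (m, n)"
  by (simp add: sum.bordered_grid gordon_process_def mat_vec_def sum_distrib_left mult_ac)

lemma decoupled_process_value:
  "(\<Sum>k\<in>{..m} \<times> {..n}. decoupled_process m n (x, y) k * \<omega> k) =
    (\<Sum>i<m. y i * \<omega> (i, n)) + (\<Sum>j<n. x j * \<omega> (m, j))"
  by (simp add: sum.bordered_grid decoupled_process_def)

lemma gordon_process_cov:
  "(\<Sum>k\<in>{..m} \<times> {..n}. gordon_process m n (x, y) k * gordon_process m n (x', y') k) =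
    (\<Sum>j<n. x j * x' j) * (\<Sum>i<m. y i * y' i) + 1"
  by (simp add: sum.bordered_grid gordon_process_def sum_product mult_ac sum.swap[of _ "{..<m}"])

lemma decoupled_process_cov:
  "(\<Sum>k\<in>{..m} \<times> {..n}. decoupled_process m n (x, y) k * decoupled_process m n (x', y') k) =
    (\<Sum>j<n. x j * x' j) + (\<Sum>i<m. y i * y' i)"
  by (simp add: sum.bordered_grid decoupled_process_def)

lemma gordon_decoupled_orthogonal:
  "(\<Sum>k\<in>{..m} \<times> {..n}. gordon_process m n p k * decoupled_process m n q k) = 0"
  by (cases p; cases q) (simp add: sum.bordered_grid decoupled_process_def gordon_process_def)

text \<open>
  The norm of \<open>g\<close> is not a sum over coordinates. It is replaced by \<open>\<parallel>g\<parallel>\<^sup>2 / (2 sqrt m) + sqrt m / 2\<close>, which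
  is an upper bound by the inequality of arithmetic and geometric means and is nearly attained because
  \<open>\<parallel>g\<parallel>\<close> concentrates at \<open>sqrt m\<close>. The exponential then is a product of functions of single coordinates.
  The upper bound on \<open>l\<close> keeps the coefficient \<open>a = l / (2 sqrt m)\<close> of the squares at most \<open>1/4\<close>.
\<close>

lemma decoupled_mgf:
  assumes m: "0 < m" and n: "0 < n" and l: "0 \<le> l" "l \<le> sqrt (real m) / 2"
  shows "(\<integral>\<^sup>+\<omega>. ennreal (exp (l * (L2_set (\<lambda>i. \<omega> (i, n)) {..<m} + (\<Sum>j<n. \<bar>\<omega> (m, j)\<bar>) / sqrt (real n)))) \<partial>gauss ({..m} \<times> {..n}))
    \<le> ennreal (exp (l * (sqrt (real m) + sqrt (2 / pi) * sqrt (real n)) + 3 / 2 * l\<^sup>2))"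
proof -
  interpret product_prob_space "\<lambda>_. std_gauss" by (rule product_prob_space_std_gauss)
  define a where "a = l / (2 * sqrt (real m))"
  define s where "s = l / sqrt (real n)"
  have sm: "0 < sqrt (real m)" and sn: "0 < sqrt (real n)" using m n by auto
  have a: "0 \<le> a" "a \<le> 1 / 4" using l sm by (auto simp: a_def field_simps)
  have s: "0 \<le> s" using l by (simp add: s_def)
  define f where "f k t = (if fst k < m \<and> snd k = n then exp (a * t\<^sup>2) else if fst k = m \<and> snd k < n then exp (s * \<bar>t\<bar>) else 1)"
    for k :: "nat \<times> nat" and t :: real
  have f_meas[measurable]: "f k \<in> borel_measurable borel" for k unfolding f_def by measurable
  have f_prod: "(\<Prod>k\<in>{..m} \<times> {..n}. f k (\<omega> k)) = (\<Prod>i<m. exp (a * (\<omega> (i, n))\<^sup>2)) * (\<Prod>j<n. exp (s * \<bar>\<omega> (m, j)\<bar>))" for \<omega>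
    by (simp add: prod.bordered_grid f_def)
  have bound: "exp (l * (L2_set (\<lambda>i. \<omega> (i, n)) {..<m} + (\<Sum>j<n. \<bar>\<omega> (m, j)\<bar>) / sqrt (real n))) \<le>
      exp (l * sqrt (real m) / 2) * (\<Prod>k\<in>{..m} \<times> {..n}. f k (\<omega> k))" for \<omega>
  proof -
    define r where "r = L2_set (\<lambda>i. \<omega> (i, n)) {..<m}"
    have r2: "r\<^sup>2 = (\<Sum>i<m. (\<omega> (i, n))\<^sup>2)" by (simp add: r_def L2_set_def sum_nonneg)
    have "0 \<le> (r - sqrt (real m))\<^sup>2" by simp
    then have "2 * r * sqrt (real m) \<le> r\<^sup>2 + real m" by (simp add: power2_diff)
    then have "r \<le> r\<^sup>2 / (2 * sqrt (real m)) + sqrt (real m) / 2"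
      using sm by (simp add: field_simps)
    from mult_left_mono[OF this l(1)] have "l * r \<le> a * r\<^sup>2 + l * sqrt (real m) / 2"
      by (simp add: a_def field_simps)
    then have "l * (r + (\<Sum>j<n. \<bar>\<omega> (m, j)\<bar>) / sqrt (real n)) \<le>
        l * sqrt (real m) / 2 + (a * r\<^sup>2 + s * (\<Sum>j<n. \<bar>\<omega> (m, j)\<bar>))"
      by (simp add: s_def distrib_left)
    then have "exp (l * (r + (\<Sum>j<n. \<bar>\<omega> (m, j)\<bar>) / sqrt (real n))) \<le>
        exp (l * sqrt (real m) / 2) * (exp (a * r\<^sup>2) * exp (s * (\<Sum>j<n. \<bar>\<omega> (m, j)\<bar>)))"
      by (simp add: exp_add[symmetric])
    also have "exp (a * r\<^sup>2) = (\<Prod>i<m. exp (a * (\<omega> (i, n))\<^sup>2))"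
      unfolding r2 by (simp add: sum_distrib_left exp_sum)
    also have "exp (s * (\<Sum>j<n. \<bar>\<omega> (m, j)\<bar>)) = (\<Prod>j<n. exp (s * \<bar>\<omega> (m, j)\<bar>))"
      by (simp add: sum_distrib_left exp_sum)
    finally show ?thesis by (simp add: r_def f_prod)
  qed
  have f0: "0 \<le> f k t" for k t by (simp add: f_def)
  have "(\<integral>\<^sup>+\<omega>. (\<Prod>k\<in>{..m} \<times> {..n}. ennreal (f k (\<omega> k))) \<partial>gauss ({..m} \<times> {..n})) =
      (\<Prod>k\<in>{..m} \<times> {..n}. \<integral>\<^sup>+t. ennreal (f k t) \<partial>std_gauss)"
    by (rule product_nn_integral_prod) auto
  also have "\<dots> = (\<integral>\<^sup>+t. ennreal (exp (a * t\<^sup>2)) \<partial>std_gauss) ^ m * (\<integral>\<^sup>+t. ennreal (exp (s * \<bar>t\<bar>)) \<partial>std_gauss) ^ n"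
    using prob_space.emeasure_space_1[OF prob_space_std_gauss] by (simp add: prod.bordered_grid f_def)
  also have "\<dots> \<le> ennreal (exp (a + 4 * a\<^sup>2)) ^ m * ennreal (exp (s * sqrt (2 / pi) + s\<^sup>2 / 2)) ^ n"
    using gauss_mgf_square_le[OF a] gauss_mgf_abs_le[OF s] by (intro mult_mono power_mono) auto
  also have "\<dots> = ennreal (exp (real m * (a + 4 * a\<^sup>2) + real n * (s * sqrt (2 / pi) + s\<^sup>2 / 2)))"
    by (simp add: ennreal_power ennreal_mult[symmetric] exp_add exp_of_nat_mult)
  also have "real m * (a + 4 * a\<^sup>2) + real n * (s * sqrt (2 / pi) + s\<^sup>2 / 2) =
      l * sqrt (real m) / 2 + (sqrt (2 / pi) * sqrt (real n) * l + 3 / 2 * l\<^sup>2)"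
  proof -
    have "real m * a = l * sqrt (real m) / 2" "real m * a\<^sup>2 = l\<^sup>2 / 4"
      using m by (simp_all add: a_def power_divide power_mult_distrib real_div_sqrt field_simps)
    moreover have "real n * s = l * sqrt (real n)" "real n * s\<^sup>2 = l\<^sup>2"
      using n by (simp_all add: s_def power_divide real_div_sqrt field_simps)
    moreover have "real m * (a + 4 * a\<^sup>2) + real n * (s * sqrt (2 / pi) + s\<^sup>2 / 2) =
        real m * a + 4 * (real m * a\<^sup>2) + (real n * s) * sqrt (2 / pi) + real n * s\<^sup>2 / 2"
      by (simp add: algebra_simps)
    ultimately show ?thesis by simp
  qed
  finally have factors: "(\<integral>\<^sup>+\<omega>. (\<Prod>k\<in>{..m} \<times> {..n}. ennreal (f k (\<omega> k))) \<partial>gauss ({..m} \<times> {..n})) \<le>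
      ennreal (exp (l * sqrt (real m) / 2 + (sqrt (2 / pi) * sqrt (real n) * l + 3 / 2 * l\<^sup>2)))" .
  have "(\<integral>\<^sup>+\<omega>. ennreal (exp (l * (L2_set (\<lambda>i. \<omega> (i, n)) {..<m} + (\<Sum>j<n. \<bar>\<omega> (m, j)\<bar>) / sqrt (real n)))) \<partial>gauss ({..m} \<times> {..n})) \<le>
      (\<integral>\<^sup>+\<omega>. ennreal (exp (l * sqrt (real m) / 2)) * (\<Prod>k\<in>{..m} \<times> {..n}. ennreal (f k (\<omega> k))) \<partial>gauss ({..m} \<times> {..n}))"
    using bound f0 by (intro nn_integral_mono) (simp add: prod_ennreal ennreal_mult[symmetric] prod_nonneg ennreal_leI)
  also have "\<dots> = ennreal (exp (l * sqrt (real m) / 2)) * (\<integral>\<^sup>+\<omega>. (\<Prod>k\<in>{..m} \<times> {..n}. ennreal (f k (\<omega> k))) \<partial>gauss ({..m} \<times> {..n}))"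
    by (rule nn_integral_cmult) measurable
  also have "\<dots> \<le> ennreal (exp (l * sqrt (real m) / 2)) *
      ennreal (exp (l * sqrt (real m) / 2 + (sqrt (2 / pi) * sqrt (real n) * l + 3 / 2 * l\<^sup>2)))"
    by (rule mult_left_mono[OF factors]) simp
  also have "\<dots> = ennreal (exp (l * (sqrt (real m) + sqrt (2 / pi) * sqrt (real n)) + 3 / 2 * l\<^sup>2))"
    by (simp add: ennreal_mult[symmetric] exp_add[symmetric] algebra_simps)
  finally show ?thesis .
qed

lemma xi_p_cong:
  assumes "\<And>i j. i < m \<Longrightarrow> j < n \<Longrightarrow> A i j = B i j"
  shows "xi_p m n A = xi_p m n B"
  unfolding xi_p_def mat_vec_def using assms
  by (intro arg_cong[where f = Max] image_cong L2_set_cong sum.cong refl) auto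

lemma xi_p_measurable:
  assumes "\<And>i j. i < m \<Longrightarrow> j < n \<Longrightarrow> (\<lambda>\<omega>. A \<omega> i j) \<in> borel_measurable N"
  shows "(\<lambda>\<omega>. xi_p m n (A \<omega>)) \<in> borel_measurable N"
  unfolding xi_p_def mat_vec_def L2_set_def using assms
  by (intro borel_measurable_Max finite_scaled_cube borel_measurable_sqrt borel_measurable_sum
    borel_measurable_power borel_measurable_times borel_measurable_const) auto

lemma xi_p_nonneg: "0 \<le> xi_p m n A"
proof -
  obtain x where "x \<in> scaled_cube n" using scaled_cube_nonempty by auto
  then have "L2_set (mat_vec n A x) {..<m} \<le> xi_p m n A"
    unfolding xi_p_def by (intro Max_ge) (auto simp: finite_scaled_cube)
  then show ?thesis using L2_set_nonneg order_trans by blast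
qed

text \<open>
  The corner variable is independent of the matrix block, so it contributes its own moment generating
  function as a factor; the border variables integrate to \<open>1\<close>.
\<close>

lemma xi_p_mgf_corner:
  fixes m n :: nat
  shows "(\<integral>\<^sup>+\<omega>. ennreal (exp (c * xi_p m n (\<lambda>i j. \<omega> (i, j)) + l * \<omega> (m, n))) \<partial>gauss ({..m} \<times> {..n})) =
    (\<integral>\<^sup>+\<omega>. ennreal (exp (c * xi_p m n (\<lambda>i j. \<omega> (i, j)))) \<partial>gauss ({..<m} \<times> {..<n})) * ennreal (exp (l\<^sup>2 / 2))"
proof -
  interpret product_prob_space "\<lambda>_. std_gauss" by (rule product_prob_space_std_gauss)
  define I where "I = {..<m} \<times> {..<n}"
  define J where "J = {..m} \<times> {..n} - I"
  have IJ: "I \<inter> J = {}" "finite I" "finite J" "I \<union> J = {..m} \<times> {..n}" "(m, n) \<in> J"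
    by (auto simp: I_def J_def)
  let ?\<xi> = "\<lambda>\<omega>. xi_p m n (\<lambda>i j. \<omega> (i, j))"
  have \<xi>_meas: "?\<xi> \<in> borel_measurable (gauss L)" if "I \<subseteq> L" for L
    using that by (intro xi_p_measurable) (auto simp: I_def intro!: measurable_component_singleton)
  have [measurable]: "?\<xi> \<in> borel_measurable (gauss I)" "?\<xi> \<in> borel_measurable (gauss (I \<union> J))"
    by (intro \<xi>_meas; blast)+
  have [measurable]: "(\<lambda>\<omega>. \<omega> (m, n)) \<in> borel_measurable (gauss (I \<union> J))" "(\<lambda>\<omega>. \<omega> (m, n)) \<in> borel_measurable (gauss J)"
    using IJ by (auto intro!: measurable_component_singleton)
  have shift: "(\<integral>\<^sup>+y. ennreal (exp (l * y (m, n))) \<partial>gauss J) = ennreal (exp (l\<^sup>2 / 2))"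
  proof -
    have "(\<integral>\<^sup>+y. ennreal (exp (l * y (m, n))) \<partial>gauss J) =
        (\<integral>\<^sup>+y. (\<Prod>k\<in>J. if k = (m, n) then ennreal (exp (l * y k)) else 1) \<partial>gauss J)"
      using IJ by (simp add: prod.delta)
    also have "\<dots> = (\<Prod>k\<in>J. \<integral>\<^sup>+t. (if k = (m, n) then ennreal (exp (l * t)) else 1) \<partial>std_gauss)"
      using IJ by (intro product_nn_integral_prod) auto
    also have "\<dots> = (\<Prod>k\<in>J. if k = (m, n) then ennreal (exp (l\<^sup>2 / 2)) else 1)"
      using prob_space.emeasure_space_1[OF prob_space_std_gauss] by (intro prod.cong) (auto simp: gauss_mgf)
    finally show ?thesis using IJ by (simp add: prod.delta)
  qed
  have "(\<integral>\<^sup>+\<omega>. ennreal (exp (c * ?\<xi> \<omega> + l * \<omega> (m, n))) \<partial>gauss (I \<union> J)) =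
      (\<integral>\<^sup>+x. (\<integral>\<^sup>+y. ennreal (exp (c * ?\<xi> (merge I J (x, y)) + l * merge I J (x, y) (m, n))) \<partial>gauss J) \<partial>gauss I)"
    by (rule product_nn_integral_fold[OF IJ(1-3)]) measurable
  also have "\<dots> = (\<integral>\<^sup>+x. (\<integral>\<^sup>+y. ennreal (exp (c * ?\<xi> x)) * ennreal (exp (l * y (m, n))) \<partial>gauss J) \<partial>gauss I)"
  proof (intro nn_integral_cong)
    fix x y :: "nat \<times> nat \<Rightarrow> real"
    have "?\<xi> (merge I J (x, y)) = ?\<xi> x" by (rule xi_p_cong) (simp add: merge_def I_def)
    moreover have "merge I J (x, y) (m, n) = y (m, n)" using IJ by (simp add: merge_def I_def)
    ultimately show "ennreal (exp (c * ?\<xi> (merge I J (x, y)) + l * merge I J (x, y) (m, n))) =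
        ennreal (exp (c * ?\<xi> x)) * ennreal (exp (l * y (m, n)))"
      by (simp add: ennreal_mult[symmetric] exp_add)
  qed
  also have "\<dots> = (\<integral>\<^sup>+x. ennreal (exp (c * ?\<xi> x)) * ennreal (exp (l\<^sup>2 / 2)) \<partial>gauss I)"
    by (subst nn_integral_cmult) (simp_all add: shift)
  also have "\<dots> = (\<integral>\<^sup>+x. ennreal (exp (c * ?\<xi> x)) \<partial>gauss I) * ennreal (exp (l\<^sup>2 / 2))"
    by (rule nn_integral_multc) measurable
  finally show ?thesis unfolding IJ(4) by (simp add: I_def)
qed

text \<open>
  Gordon's comparison on the net. The factor \<open>exp (l\<^sup>2 / 2)\<close> of the corner variable cancels against
  one third of the quadratic term of \<open>decoupled_mgf\<close>.
\<close>

lemma xi_p_mgf_net: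
  assumes m: "0 < m" and n: "0 < n" and l: "0 < l" "l \<le> sqrt (real m) / 2" and \<epsilon>: "0 < \<epsilon>" "\<epsilon> < 1"
  shows "(\<integral>\<^sup>+\<omega>. ennreal (exp ((1 - \<epsilon>) * l * xi_p m n (\<lambda>i j. \<omega> (i, j)))) \<partial>gauss ({..<m} \<times> {..<n}))
    \<le> ennreal (exp (l * (sqrt (real m) + sqrt (2 / pi) * sqrt (real n)) + l\<^sup>2))"
proof -
  obtain T :: "(nat \<Rightarrow> real) set" where T: "finite T" "T \<noteq> {}" "\<And>y. y \<in> T \<Longrightarrow> (\<Sum>i<m. (y i)\<^sup>2) = 1"
    and net: "\<And>v. \<exists>y\<in>T. (1 - \<epsilon>) * L2_set v {..<m} \<le> (\<Sum>i<m. y i * v i)"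
    by (rule sphere_net[OF m \<epsilon>(1)]) (rule that)
  define I where "I = scaled_cube n \<times> T"
  have I: "finite I" "I \<noteq> {}" using T finite_scaled_cube scaled_cube_nonempty by (auto simp: I_def)
  let ?K = "{..m} \<times> {..n}"
  let ?a = "gordon_process m n" and ?b = "decoupled_process m n"
  let ?\<xi> = "\<lambda>\<omega>. xi_p m n (\<lambda>i j. \<omega> (i, j))"
  let ?B = "l * (sqrt (real m) + sqrt (2 / pi) * sqrt (real n))"
  have unit: "(\<Sum>j<n. fst p j * fst p j) = 1" "(\<Sum>i<m. snd p i * snd p i) = 1" if "p \<in> I" for p
    using that scaled_cube_unit[OF _ n] T(3) by (auto simp: I_def power2_eq_square)
  have cov: "(\<Sum>k\<in>?K. ?a p k * ?a q k) - (\<Sum>k\<in>?K. ?b p k * ?b q k) =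
      (1 - (\<Sum>j<n. fst p j * fst q j)) * (1 - (\<Sum>i<m. snd p i * snd q i))" for p q
    by (cases p; cases q) (simp add: gordon_process_cov decoupled_process_cov algebra_simps)
  have le: "(\<Sum>k\<in>?K. ?b p k * ?b q k) \<le> (\<Sum>k\<in>?K. ?a p k * ?a q k)" if "p \<in> I" "q \<in> I" for p q
  proof -
    have "(\<Sum>j<n. fst p j * fst q j) \<le> 1" "(\<Sum>i<m. snd p i * snd q i) \<le> 1"
      using unit[OF that(1)] unit[OF that(2)] by (auto intro!: inner_unit_le_1 simp: power2_eq_square)
    then have "0 \<le> (1 - (\<Sum>j<n. fst p j * fst q j)) * (1 - (\<Sum>i<m. snd p i * snd q i))" by simp
    then show ?thesis using cov[of p q] by linarith
  qed
  have eq: "(\<Sum>k\<in>?K. ?a p k * ?a p k) = (\<Sum>k\<in>?K. ?b p k * ?b p k)" if "p \<in> I" for p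
    using cov[of p p] unit[OF that] by simp
  have "(\<integral>\<^sup>+\<omega>. ennreal (exp ((1 - \<epsilon>) * l * ?\<xi> \<omega> + l * \<omega> (m, n))) \<partial>gauss ?K) \<le>
      (\<integral>\<^sup>+\<omega>. ennreal (exp (l * Max ((\<lambda>p. \<Sum>k\<in>?K. ?a p k * \<omega> k) ` I))) \<partial>gauss ?K)"
  proof (intro nn_integral_mono ennreal_leI)
    fix \<omega> :: "nat \<times> nat \<Rightarrow> real"
    let ?A = "\<lambda>i j. \<omega> (i, j)"
    have "xi_p m n ?A \<in> (\<lambda>x. L2_set (mat_vec n ?A x) {..<m}) ` scaled_cube n"
      unfolding xi_p_def using finite_scaled_cube scaled_cube_nonempty by (intro Max_in) auto
    then obtain x where x: "x \<in> scaled_cube n" "xi_p m n ?A = L2_set (mat_vec n ?A x) {..<m}" by auto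
    obtain y where y: "y \<in> T" "(1 - \<epsilon>) * xi_p m n ?A \<le> (\<Sum>i<m. y i * mat_vec n ?A x i)"
      using net[of "mat_vec n ?A x"] unfolding x(2) by auto
    have "(1 - \<epsilon>) * xi_p m n ?A + \<omega> (m, n) \<le> (\<Sum>k\<in>?K. ?a (x, y) k * \<omega> k)"
      using y(2) by (simp add: gordon_process_value)
    also have "\<dots> \<le> Max ((\<lambda>p. \<Sum>k\<in>?K. ?a p k * \<omega> k) ` I)"
      using I x(1) y(1) by (intro Max_ge) (auto simp: I_def)
    finally show "exp ((1 - \<epsilon>) * l * ?\<xi> \<omega> + l * \<omega> (m, n)) \<le> exp (l * Max ((\<lambda>p. \<Sum>k\<in>?K. ?a p k * \<omega> k) ` I))"
      using mult_left_mono[OF _ less_imp_le[OF l(1)]] by (fastforce simp: algebra_simps)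
  qed
  also have "\<dots> \<le> (\<integral>\<^sup>+\<omega>. ennreal (exp (l * Max ((\<lambda>p. \<Sum>k\<in>?K. ?b p k * \<omega> k) ` I))) \<partial>gauss ?K)"
    by (intro gaussian_comparison_exp_Max I l(1) gordon_decoupled_orthogonal le eq) auto
  also have "\<dots> \<le> (\<integral>\<^sup>+\<omega>. ennreal (exp (l * (L2_set (\<lambda>i. \<omega> (i, n)) {..<m} + (\<Sum>j<n. \<bar>\<omega> (m, j)\<bar>) / sqrt (real n)))) \<partial>gauss ?K)"
  proof (intro nn_integral_mono ennreal_leI)
    fix \<omega> :: "nat \<times> nat \<Rightarrow> real"
    have "(\<Sum>k\<in>?K. ?b p k * \<omega> k) \<le> L2_set (\<lambda>i. \<omega> (i, n)) {..<m} + (\<Sum>j<n. \<bar>\<omega> (m, j)\<bar>) / sqrt (real n)" if "p \<in> I" for p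
    proof -
      obtain x y where p: "p = (x, y)" "x \<in> scaled_cube n" "y \<in> T" using \<open>p \<in> I\<close> by (auto simp: I_def)
      have "(\<Sum>i<m. y i * \<omega> (i, n)) \<le> (\<Sum>i<m. \<bar>y i\<bar> * \<bar>\<omega> (i, n)\<bar>)"
        by (intro sum_mono) (metis abs_ge_self abs_mult)
      also have "\<dots> \<le> L2_set y {..<m} * L2_set (\<lambda>i. \<omega> (i, n)) {..<m}" by (rule L2_set_mult_ineq)
      also have "L2_set y {..<m} = 1" using T(3)[OF p(3)] by (simp add: L2_set_def)
      finally have 1: "(\<Sum>i<m. y i * \<omega> (i, n)) \<le> L2_set (\<lambda>i. \<omega> (i, n)) {..<m}" by simp
      have "(\<Sum>j<n. x j * \<omega> (m, j)) \<le> (\<Sum>j<n. \<bar>\<omega> (m, j)\<bar> / sqrt (real n))"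
      proof (rule sum_mono)
        fix j assume "j \<in> {..<n}"
        then have "\<bar>x j * \<omega> (m, j)\<bar> = \<bar>\<omega> (m, j)\<bar> / sqrt (real n)"
          using scaled_cube_abs[OF p(2)] by (simp add: abs_mult)
        then show "x j * \<omega> (m, j) \<le> \<bar>\<omega> (m, j)\<bar> / sqrt (real n)" by linarith
      qed
      with 1 show ?thesis by (simp add: p(1) decoupled_process_value sum_divide_distrib)
    qed
    then show "exp (l * Max ((\<lambda>p. \<Sum>k\<in>?K. ?b p k * \<omega> k) ` I)) \<le>
        exp (l * (L2_set (\<lambda>i. \<omega> (i, n)) {..<m} + (\<Sum>j<n. \<bar>\<omega> (m, j)\<bar>) / sqrt (real n)))"
      using I l(1) by (simp add: Max_le_iff)
  qed
  also have "\<dots> \<le> ennreal (exp (?B + 3 / 2 * l\<^sup>2))"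
    by (rule decoupled_mgf) (use m n l in auto)
  also have "\<dots> = ennreal (exp (l\<^sup>2 / 2)) * ennreal (exp (?B + l\<^sup>2))"
    by (simp add: ennreal_mult[symmetric] exp_add[symmetric])
  finally have "ennreal (exp (l\<^sup>2 / 2)) * (\<integral>\<^sup>+\<omega>. ennreal (exp ((1 - \<epsilon>) * l * ?\<xi> \<omega>)) \<partial>gauss ({..<m} \<times> {..<n})) \<le>
      ennreal (exp (l\<^sup>2 / 2)) * ennreal (exp (?B + l\<^sup>2))"
    using xi_p_mgf_corner[where c = "(1 - \<epsilon>) * l" and m = m and n = n and l = l] l \<epsilon> by (simp add: mult.commute)
  then show ?thesis
    by (subst (asm) ennreal_mult_le_mult_iff) auto
qed

text \<open>
  For \<open>l' > l\<close> the choice \<open>\<epsilon> = 1 - l / l'\<close> turns \<open>(1 - \<epsilon>) * l'\<close> into \<open>l\<close>; let \<open>l'\<close> decrease to \<open>l\<close>.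
\<close>

lemma xi_p_mgf:
  assumes m: "0 < m" and n: "0 < n" and l: "0 < l" "l < sqrt (real m) / 2"
  shows "(\<integral>\<^sup>+\<omega>. ennreal (exp (l * xi_p m n (\<lambda>i j. \<omega> (i, j)))) \<partial>gauss ({..<m} \<times> {..<n}))
    \<le> ennreal (exp (l * (sqrt (real m) + sqrt (2 / pi) * sqrt (real n)) + l\<^sup>2))" (is "?E \<le> ennreal (?R l)")
proof (rule tendsto_lowerbound)
  show "((\<lambda>l'. ennreal (?R l')) \<longlongrightarrow> ennreal (?R l)) (at_right l)"
    by (intro tendsto_ennrealI tendsto_intros)
  have "?E \<le> ennreal (?R l')" if l': "l < l'" "l' < sqrt (real m) / 2" for l'
  proof -
    have "(1 - (1 - l / l')) * l' = l" using l l' by simp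
    then show ?thesis
      using xi_p_mgf_net[OF m n, of l' "1 - l / l'"] l l' by simp
  qed
  then show "\<forall>\<^sub>F l' in at_right l. ?E \<le> ennreal (?R l')"
    using l(2) unfolding eventually_at_right_field by (intro exI[of _ "sqrt (real m) / 2"]) simp
qed simp

text \<open>
  The law of the entries is the product of standard normal laws, so the bound transfers from the
  canonical product space to any probability space carrying such a matrix.
\<close>

lemma std_normal_matrix_mgf:
  assumes H: "std_normal_matrix M m n H" and m: "0 < m" and n: "0 < n" and l: "0 < l" "l < sqrt (real m) / 2"
  shows "(\<integral>\<^sup>+\<omega>. ennreal (exp (l * xi_p m n (\<lambda>i j. H i j \<omega>))) \<partial>M)
    \<le> ennreal (exp (l * (sqrt (real m) + sqrt (2 / pi) * sqrt (real n)) + l\<^sup>2))"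
proof -
  interpret prob_space M using H by (simp add: std_normal_matrix_def)
  define I where "I = {..<m} \<times> {..<n}"
  let ?X = "\<lambda>(i, j). H i j"
  have I: "I \<noteq> {}" using m n by (auto simp: I_def)
  have dist: "distributed M lborel (?X k) std_normal_density" if "k \<in> I" for k
    using H that by (auto simp: std_normal_matrix_def I_def)
  have rv: "?X k \<in> borel_measurable M" if "k \<in> I" for k
    using distributed_measurable[OF dist[OF that]] by simp
  have indep: "indep_vars (\<lambda>_. borel) ?X I"
    using H by (simp add: std_normal_matrix_def I_def)
  have "distr M borel (?X k) = std_gauss" if "k \<in> I" for k
    using distributed_distr_eq_density[OF dist[OF that]] by (simp cong: distr_cong)
  then have "Pi\<^sub>M I (\<lambda>k. distr M borel (?X k)) = gauss I"
    by (intro PiM_cong) auto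
  then have D: "distr M (Pi\<^sub>M I (\<lambda>_. borel)) (\<lambda>\<omega>. \<lambda>k\<in>I. ?X k \<omega>) = gauss I"
    using indep_vars_iff_distr_eq_PiM'[of I ?X "\<lambda>_. borel", OF I rv] indep by simp
  let ?\<xi> = "\<lambda>\<omega>. xi_p m n (\<lambda>i j. \<omega> (i, j))"
  have [measurable]: "?\<xi> \<in> borel_measurable (Pi\<^sub>M I (\<lambda>_. borel))"
    by (intro xi_p_measurable) (auto simp: I_def intro!: measurable_component_singleton)
  have "(\<integral>\<^sup>+\<omega>. ennreal (exp (l * ?\<xi> \<omega>)) \<partial>gauss I) =
      (\<integral>\<^sup>+\<omega>. ennreal (exp (l * ?\<xi> (\<lambda>k\<in>I. ?X k \<omega>))) \<partial>M)"
    unfolding D[symmetric] using rv by (intro nn_integral_distr measurable_restrict) auto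
  also have "\<dots> = (\<integral>\<^sup>+\<omega>. ennreal (exp (l * xi_p m n (\<lambda>i j. H i j \<omega>))) \<partial>M)"
  proof (rule nn_integral_cong)
    fix \<omega>
    have "?\<xi> (\<lambda>k\<in>I. ?X k \<omega>) = xi_p m n (\<lambda>i j. H i j \<omega>)"
      by (rule xi_p_cong) (simp add: I_def)
    then show "ennreal (exp (l * ?\<xi> (\<lambda>k\<in>I. ?X k \<omega>))) = ennreal (exp (l * xi_p m n (\<lambda>i j. H i j \<omega>)))"
      by simp
  qed
  finally show ?thesis
    using xi_p_mgf[OF m n l] by (simp add: I_def)
qed

section \<open>Expectation and concentration\<close>

lemma std_normal_matrix_xi_p_measurable:
  assumes "std_normal_matrix M m n H"
  shows "(\<lambda>\<omega>. xi_p m n (\<lambda>i j. H i j \<omega>)) \<in> borel_measurable M"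
proof (rule xi_p_measurable)
  fix i j assume "i < m" "j < n"
  then have "distributed M lborel (H i j) std_normal_density"
    using assms by (simp add: std_normal_matrix_def)
  from distributed_measurable[OF this] show "H i j \<in> borel_measurable M" by simp
qed

lemma xi_p_tail:
  assumes H: "std_normal_matrix M m n H" and m: "0 < m" and n: "0 < n" and l: "0 < l" "l < sqrt (real m) / 2"
  shows "measure M {\<omega> \<in> space M. u < xi_p m n (\<lambda>i j. H i j \<omega>)} \<le>
    exp (l * (sqrt (real m) + sqrt (2 / pi) * sqrt (real n) - u) + l\<^sup>2)"
proof -
  interpret prob_space M using H by (simp add: std_normal_matrix_def)
  let ?\<xi> = "\<lambda>\<omega>. xi_p m n (\<lambda>i j. H i j \<omega>)"
  note std_normal_matrix_xi_p_measurable[OF H, measurable]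
  have "emeasure M {\<omega> \<in> space M. u < ?\<xi> \<omega>} = (\<integral>\<^sup>+\<omega>. indicator {\<omega> \<in> space M. u < ?\<xi> \<omega>} \<omega> \<partial>M)"
    by simp
  also have "\<dots> \<le> (\<integral>\<^sup>+\<omega>. ennreal (exp (- l * u)) * ennreal (exp (l * ?\<xi> \<omega>)) \<partial>M)"
  proof (rule nn_integral_mono)
    fix \<omega>
    have "1 \<le> exp (- l * u) * exp (l * ?\<xi> \<omega>)" if "u < ?\<xi> \<omega>"
      using that l by (simp add: exp_add[symmetric])
    then show "indicator {\<omega> \<in> space M. u < ?\<xi> \<omega>} \<omega> \<le> ennreal (exp (- l * u)) * ennreal (exp (l * ?\<xi> \<omega>))"
      by (simp add: indicator_def ennreal_mult[symmetric] ennreal_ge_1)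
  qed
  also have "\<dots> = ennreal (exp (- l * u)) * (\<integral>\<^sup>+\<omega>. ennreal (exp (l * ?\<xi> \<omega>)) \<partial>M)"
    by (rule nn_integral_cmult) measurable
  also have "\<dots> \<le> ennreal (exp (- l * u)) * ennreal (exp (l * (sqrt (real m) + sqrt (2 / pi) * sqrt (real n)) + l\<^sup>2))"
    by (rule mult_left_mono[OF std_normal_matrix_mgf[OF H m n l]]) simp
  also have "\<dots> = ennreal (exp (l * (sqrt (real m) + sqrt (2 / pi) * sqrt (real n) - u) + l\<^sup>2))"
    by (simp add: ennreal_mult[symmetric] exp_add[symmetric] algebra_simps)
  finally show ?thesis by (simp add: emeasure_eq_measure)
qed

text \<open>
  By \<open>1 + l \<xi> \<le> exp (l \<xi>)\<close> the mean is at most \<open>(exp (l B + l\<^sup>2) - 1) / l\<close>, whose limit as \<open>l\<close> tends to \<open>0\<close>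
  is the derivative \<open>B\<close> of \<open>exp (l B + l\<^sup>2)\<close> at \<open>l = 0\<close>.
\<close>

lemma xi_p_expectation:
  assumes H: "std_normal_matrix M m n H" and m: "0 < m" and n: "0 < n"
  shows "integrable M (\<lambda>\<omega>. xi_p m n (\<lambda>i j. H i j \<omega>))"
    and "(\<integral>\<omega>. xi_p m n (\<lambda>i j. H i j \<omega>) \<partial>M) \<le> sqrt (real m) + sqrt (2 / pi) * sqrt (real n)"
proof -
  interpret prob_space M using H by (simp add: std_normal_matrix_def)
  let ?\<xi> = "\<lambda>\<omega>. xi_p m n (\<lambda>i j. H i j \<omega>)"
  define B where "B = sqrt (real m) + sqrt (2 / pi) * sqrt (real n)"
  define s where "s = sqrt (real m) / 2"
  have s: "0 < s" using m by (simp add: s_def)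
  note std_normal_matrix_xi_p_measurable[OF H, measurable]
  have exp_int: "integrable M (\<lambda>\<omega>. exp (l * ?\<xi> \<omega>))" and exp_le: "expectation (\<lambda>\<omega>. exp (l * ?\<xi> \<omega>)) \<le> exp (l * B + l\<^sup>2)"
    if l: "0 < l" "l < s" for l
  proof -
    have le: "(\<integral>\<^sup>+\<omega>. ennreal (exp (l * ?\<xi> \<omega>)) \<partial>M) \<le> ennreal (exp (l * B + l\<^sup>2))"
      using std_normal_matrix_mgf[OF H m n l[unfolded s_def]] by (simp add: B_def)
    then show int: "integrable M (\<lambda>\<omega>. exp (l * ?\<xi> \<omega>))"
      by (intro integrableI_nonneg) (auto simp: le_less_trans)
    show "expectation (\<lambda>\<omega>. exp (l * ?\<xi> \<omega>)) \<le> exp (l * B + l\<^sup>2)"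
      using le nn_integral_eq_integral[OF int] by simp
  qed
  show int: "integrable M ?\<xi>"
  proof (rule Bochner_Integration.integrable_bound)
    show "integrable M (\<lambda>\<omega>. exp (s / 2 * ?\<xi> \<omega>) / (s / 2))"
      using exp_int[of "s / 2"] s by (intro integrable_divide) simp
    have "?\<xi> \<omega> \<le> exp (s / 2 * ?\<xi> \<omega>) / (s / 2)" for \<omega>
      using exp_ge_add_one_self[of "s / 2 * ?\<xi> \<omega>"] s by (simp add: field_simps)
    then show "AE \<omega> in M. norm (?\<xi> \<omega>) \<le> norm (exp (s / 2 * ?\<xi> \<omega>) / (s / 2))"
      using xi_p_nonneg s by (intro AE_I2) simp
  qed measurable
  have le: "expectation ?\<xi> \<le> (exp (l * B + l\<^sup>2) - 1) / l" if l: "0 < l" "l < s" for l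
  proof -
    have "expectation (\<lambda>\<omega>. 1 + l * ?\<xi> \<omega>) \<le> expectation (\<lambda>\<omega>. exp (l * ?\<xi> \<omega>))"
      using int exp_int[OF l] exp_ge_add_one_self by (intro integral_mono) auto
    also have "expectation (\<lambda>\<omega>. 1 + l * ?\<xi> \<omega>) = 1 + l * expectation ?\<xi>"
      using int by (simp add: prob_space)
    finally have "1 + l * expectation ?\<xi> \<le> exp (l * B + l\<^sup>2)" using exp_le[OF l] by linarith
    then show ?thesis using l by (simp add: field_simps)
  qed
  have "((\<lambda>l. exp (l * B + l\<^sup>2)) has_real_derivative B) (at 0)"
    by (auto intro!: derivative_eq_intros)
  then have "((\<lambda>l. (exp (l * B + l\<^sup>2) - 1) / l) \<longlongrightarrow> B) (at 0)"
    by (simp add: DERIV_def)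
  then have lim: "((\<lambda>l. (exp (l * B + l\<^sup>2) - 1) / l) \<longlongrightarrow> B) (at_right 0)"
    by (simp add: filterlim_at_split)
  show "expectation ?\<xi> \<le> sqrt (real m) + sqrt (2 / pi) * sqrt (real n)"
    unfolding B_def[symmetric]
  proof (rule tendsto_lowerbound[OF lim])
    show "\<forall>\<^sub>F l in at_right 0. expectation ?\<xi> \<le> (exp (l * B + l\<^sup>2) - 1) / l"
      unfolding eventually_at_right_field using s le by (intro exI[of _ s]) simp
  qed simp
qed

lemma admissible_row_dim:
  assumes "0 < \<alpha>" "n \<in> admissible \<alpha>"
  shows "0 < row_dim \<alpha> n" "real (row_dim \<alpha> n) = \<alpha> * real n" "0 < n"
proof -
  obtain m :: nat where m: "0 < m" "real m = \<alpha> * real n" using assms(2) by (auto simp: admissible_def)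
  then have "row_dim \<alpha> n = m" by (simp add: row_dim_def flip: m(2))
  with m assms(1) show "0 < row_dim \<alpha> n" "real (row_dim \<alpha> n) = \<alpha> * real n" "0 < n"
    by (auto intro!: Nat.gr0I)
qed

theorem lemma3:
  fixes \<alpha> \<epsilon>1m \<epsilon>1n \<epsilon>5g :: real
    and M :: "nat \<Rightarrow> 'a measure"
    and H :: "nat \<Rightarrow> nat \<Rightarrow> nat \<Rightarrow> 'a \<Rightarrow> real"
    and u :: "nat \<Rightarrow> real"
    and \<xi> :: "nat \<Rightarrow> 'a \<Rightarrow> real"
  defines "\<xi> \<equiv> \<lambda>n \<omega>. xi_p (row_dim \<alpha> n) n (\<lambda>i j. H n i j \<omega>)"
  assumes "0 < \<alpha>"
    and "0 < \<epsilon>1m" and "0 < \<epsilon>1n" and "0 < \<epsilon>5g"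
    and "\<And>n. n \<in> admissible \<alpha> \<Longrightarrow> std_normal_matrix (M n) (row_dim \<alpha> n) n (H n)"
    and "\<And>n. n \<in> admissible \<alpha> \<Longrightarrow>
           (1 + \<epsilon>1m) * sqrt \<alpha> + (1 + \<epsilon>1n) * sqrt (2 / pi) + \<epsilon>5g < u n / sqrt (real n)"
  shows "((\<lambda>n. \<P>(\<omega> in M n. \<xi> n \<omega> \<le> u n)) \<longlongrightarrow> 1) (at_top_admissible \<alpha>) \<and>
         ((\<lambda>n. \<P>(\<omega> in M n. (\<xi> n \<omega>)\<^sup>2 \<le> (u n)\<^sup>2)) \<longlongrightarrow> 1) (at_top_admissible \<alpha>) \<and>
         (\<forall>n \<in> admissible \<alpha>.
            integrable (M n) (\<xi> n) \<and>
            (\<integral>\<omega>. \<xi> n \<omega> \<partial>M n) / sqrt (real n) \<le> sqrt \<alpha> + sqrt (2 / pi))"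
proof -
  note \<alpha> = \<open>0 < \<alpha>\<close>
  \<comment> \<open>The tail bound is used at \<open>l = c * sqrt n\<close>: the first term of the minimum makes \<open>l < sqrt m / 2\<close>,
    the second makes \<open>l\<^sup>2\<close> at most half of the gain \<open>l * \<epsilon>5g * sqrt n\<close>.\<close>
  define c where "c = min (sqrt \<alpha> / 4) (\<epsilon>5g / 2)"
  have c: "0 < c" "c < sqrt \<alpha> / 2" "c \<le> \<epsilon>5g / 2" using \<alpha> assms(5) by (auto simp: c_def min_def)
  have u: "sqrt (real n) * (sqrt \<alpha> + sqrt (2 / pi) + \<epsilon>5g) \<le> u n" if n: "n \<in> admissible \<alpha>" for n
  proof -
    have "0 < sqrt (real n)" using admissible_row_dim[OF \<alpha> n] by simp
    moreover have "sqrt \<alpha> + sqrt (2 / pi) + \<epsilon>5g \<le> u n / sqrt (real n)"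
    proof -
      have "0 \<le> \<epsilon>1m * sqrt \<alpha>" "0 \<le> \<epsilon>1n * sqrt (2 / pi)" using assms by auto
      then show ?thesis using assms(7)[OF n] by (simp add: distrib_right)
    qed
    ultimately show ?thesis by (simp add: field_simps)
  qed
  have u_pos: "0 < u n" if "n \<in> admissible \<alpha>" for n
  proof -
    have "0 < sqrt (real n) * (sqrt \<alpha> + sqrt (2 / pi) + \<epsilon>5g)"
      using admissible_row_dim[OF \<alpha> that] \<alpha> assms(5) by (intro mult_pos_pos add_pos_pos) auto
    then show ?thesis using u[OF that] by linarith
  qed
  have sqrt_row: "sqrt (real (row_dim \<alpha> n)) = sqrt \<alpha> * sqrt (real n)" if "n \<in> admissible \<alpha>" for n
    using admissible_row_dim(2)[OF \<alpha> that] by (simp add: real_sqrt_mult)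
  have lower: "1 - exp (- (c * \<epsilon>5g / 2) * real n) \<le> \<P>(\<omega> in M n. \<xi> n \<omega> \<le> u n)"
    and upper: "\<P>(\<omega> in M n. \<xi> n \<omega> \<le> u n) \<le> 1" if n: "n \<in> admissible \<alpha>" for n
  proof -
    note d = admissible_row_dim[OF \<alpha> n] and H = assms(6)[OF n]
    interpret prob_space "M n" using H by (simp add: std_normal_matrix_def)
    have [measurable]: "\<xi> n \<in> borel_measurable (M n)"
      unfolding \<xi>_def by (rule std_normal_matrix_xi_p_measurable[OF H])
    let ?r = "sqrt (real n)"
    have r: "0 < ?r" "?r\<^sup>2 = real n" using d by auto
    have "prob {\<omega> \<in> space (M n). u n < \<xi> n \<omega>} \<le>
        exp (c * ?r * (sqrt (real (row_dim \<alpha> n)) + sqrt (2 / pi) * ?r - u n) + (c * ?r)\<^sup>2)"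
      unfolding \<xi>_def using c r by (intro xi_p_tail[OF H] d) (auto simp: sqrt_row[OF n])
    also have "\<dots> \<le> exp (- (c * \<epsilon>5g / 2) * real n)"
    proof -
      have "sqrt (real (row_dim \<alpha> n)) + sqrt (2 / pi) * ?r - u n \<le> - (\<epsilon>5g * ?r)"
        using u[OF n] by (simp add: sqrt_row[OF n] algebra_simps)
      from mult_left_mono[OF this, of "c * ?r"]
      have "c * ?r * (sqrt (real (row_dim \<alpha> n)) + sqrt (2 / pi) * ?r - u n) \<le> - (c * \<epsilon>5g * ?r\<^sup>2)"
        using c r by (simp add: power2_eq_square mult_ac)
      moreover have "(c * ?r)\<^sup>2 \<le> c * \<epsilon>5g / 2 * ?r\<^sup>2"
      proof -
        have "c * c * ?r\<^sup>2 \<le> c * (\<epsilon>5g / 2) * ?r\<^sup>2"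
          using c by (intro mult_right_mono mult_left_mono) auto
        then show ?thesis by (simp add: power_mult_distrib power2_eq_square[of c])
      qed
      ultimately show ?thesis unfolding r(2) by simp
    qed
    finally have "prob {\<omega> \<in> space (M n). u n < \<xi> n \<omega>} \<le> exp (- (c * \<epsilon>5g / 2) * real n)" .
    moreover have "prob {\<omega> \<in> space (M n). u n < \<xi> n \<omega>} = 1 - \<P>(\<omega> in M n. \<xi> n \<omega> \<le> u n)"
      by (subst prob_neg[symmetric]) (auto simp: not_le)
    ultimately show "1 - exp (- (c * \<epsilon>5g / 2) * real n) \<le> \<P>(\<omega> in M n. \<xi> n \<omega> \<le> u n)" by linarith
    show "\<P>(\<omega> in M n. \<xi> n \<omega> \<le> u n) \<le> 1" by simp
  qed
  have ev: "\<forall>\<^sub>F n in at_top_admissible \<alpha>. P n" if "\<And>n. n \<in> admissible \<alpha> \<Longrightarrow> P n" for P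
    using that unfolding at_top_admissible_def eventually_inf_principal by simp
  have conc: "((\<lambda>n. \<P>(\<omega> in M n. \<xi> n \<omega> \<le> u n)) \<longlongrightarrow> 1) (at_top_admissible \<alpha>)"
  proof (rule tendsto_sandwich[OF ev[OF lower] ev[OF upper] _ tendsto_const])
    have "(\<lambda>n. 1 - exp (- (c * \<epsilon>5g / 2) * real n)) \<longlonglongrightarrow> 1"
    proof -
      define q where "q = c * \<epsilon>5g / 2"
      have "0 < q" using c assms(5) by (simp add: q_def)
      then have "(\<lambda>n. 1 - exp (- q * real n)) \<longlonglongrightarrow> 1" by real_asymp
      then show ?thesis by (simp add: q_def)
    qed
    then show "((\<lambda>n. 1 - exp (- (c * \<epsilon>5g / 2) * real n)) \<longlongrightarrow> 1) (at_top_admissible \<alpha>)"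
      unfolding at_top_admissible_def by (rule tendsto_mono[OF inf_le1])
  qed
  have "\<P>(\<omega> in M n. \<xi> n \<omega> \<le> u n) = \<P>(\<omega> in M n. (\<xi> n \<omega>)\<^sup>2 \<le> (u n)\<^sup>2)" if "n \<in> admissible \<alpha>" for n
  proof -
    have "\<xi> n \<omega> \<le> u n \<longleftrightarrow> (\<xi> n \<omega>)\<^sup>2 \<le> (u n)\<^sup>2" for \<omega>
      using xi_p_nonneg u_pos[OF that] by (simp add: \<xi>_def power_mono_iff)
    then show ?thesis by simp
  qed
  then have conc2: "((\<lambda>n. \<P>(\<omega> in M n. (\<xi> n \<omega>)\<^sup>2 \<le> (u n)\<^sup>2)) \<longlongrightarrow> 1) (at_top_admissible \<alpha>)"
    using conc by (subst (asm) tendsto_cong[OF ev]) auto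
  have "integrable (M n) (\<xi> n) \<and> (\<integral>\<omega>. \<xi> n \<omega> \<partial>M n) / sqrt (real n) \<le> sqrt \<alpha> + sqrt (2 / pi)"
    if n: "n \<in> admissible \<alpha>" for n
  proof -
    note d = admissible_row_dim[OF \<alpha> n] and H = assms(6)[OF n]
    have "(\<integral>\<omega>. \<xi> n \<omega> \<partial>M n) \<le> sqrt (real (row_dim \<alpha> n)) + sqrt (2 / pi) * sqrt (real n)"
      unfolding \<xi>_def by (rule xi_p_expectation(2)[OF H d(1,3)])
    also have "\<dots> = (sqrt \<alpha> + sqrt (2 / pi)) * sqrt (real n)" by (simp add: sqrt_row[OF n] distrib_right)
    finally show ?thesis
      using xi_p_expectation(1)[OF H d(1,3)] d(3) by (simp add: \<xi>_def divide_le_eq)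
  qed
  with conc conc2 show ?thesis by blast
qed

end
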